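(* Let $(G,D)$ be a connected $3$-transposition group with $\theta(G)\ne 1$, so that $G=3^{\bullet h}\hat G$ with $h\geq 1$ and $\hat G=G/\theta(G)$. Let $M=M_\eta(G,D)$ and $\hat M=M_\eta(\hat G,\hat D)$, with collinearity maps $t$ and $\hat t$ respectively, and let $U=\langle c-d\mid c,d\in D,\ c\,\theta\, d\rangle\subseteq M$. Then: (a) The eigenvalues of $t$ not equal to $-1$ are of the form $\rho=3^h\hat\rho+3^h-1$, where $\hat\rho$ is an eigenvalue of $\hat t$. Furthermore, the multiplicity of $\rho$ in $M$ is the same as the multiplicity of $\hat\rho$ in $\hat M$. (b) The multiplicity of the eigenvalue $-1$ of $t$ in $M$ is $\dim(U)=\dim(M)-\dim(\hat M)=|D|-|\hat D|=(3^h-1)|\hat D|$.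
   Context: $\mathbb F$ is a field of characteristic $0$ and $\eta\in\mathbb F\setminus\{0,1\}$. A $3$-transposition group $(G,D)$ is a finite group $G$ with a normal generating subset $D$ of elements of order $2$ such that $|de|\le 3$ for all $d,e\in D$; it is connected if $D$ is a single conjugacy class. As a vector space, the Matsuo algebra $M_\eta(G,D)$ is the $\mathbb F$-space with basis $D$ (the algebra product is not needed here). For $d\in D$ put $A_d=\{e\in D\mid |de|=3\}$ and $D_d=\{e\in D\mid |de|=2\}$. The collinearity map is the linear map $t:M\to M$, $t(d)=\sum_{c\in A_d}c$ for $d\in D$. The map $\hat t$ is defined in the same way for $(\hat G,\hat D)$. The equivalence relation $\theta$ on $D$ is: $d\,\theta\,e$ iff $D_d=D_e$. The normal subgroup $\theta(G)$ is $\langle de\mid d,e\in D,\ d\,\theta\,e\rangle$; it is a $3$-group. When $\theta(G)\neq1$, $|D\cap d\theta(G)|=3^h$ for some $h\ge1$ independent of $d\in D$; $\hat G=G/\theta(G)$, $\hat D$ is the image of $D$ in $\hat G$, $(\hat G,\hat D)$ is a $3$-transposition group and $|D|=3^h|\hat D|$; this situation is denoted $G=3^{\bullet h}\hat G$. *)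

theory Defs
  imports "HOL-Algebra.Multiplicative_Group" "HOL-Algebra.Generated_Groups"
    "HOL-Library.Poly_Mapping"
begin

section \<open>3-transposition groups\<close>

locale three_transposition_group = group G
  for G :: "('g, 'm) monoid_scheme" (structure) +
  fixes D :: "'g set"
  assumes fin: "finite (carrier G)"
    and D_sub: "D \<subseteq> carrier G"
    and D_normal: "\<lbrakk>g \<in> carrier G; d \<in> D\<rbrakk> \<Longrightarrow> g \<otimes> d \<otimes> inv g \<in> D"
    and D_generates: "generate G D = carrier G"
    and D_involution: "d \<in> D \<Longrightarrow> ord d = 2"
    and D_three: "\<lbrakk>d \<in> D; e \<in> D\<rbrakk> \<Longrightarrow> ord (d \<otimes> e) \<le> 3"

locale connected_three_transposition_group = three_transposition_group +
  assumes D_class: "\<exists>d\<in>D. D = {g \<otimes> d \<otimes> inv g |g. g \<in> carrier G}"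

definition nbr3 :: "('g, 'm) monoid_scheme \<Rightarrow> 'g set \<Rightarrow> 'g \<Rightarrow> 'g set"  \<comment> \<open>the set \<open>A\<^sub>d\<close>\<close>
  where "nbr3 G D d = {e \<in> D. group.ord G (d \<otimes>\<^bsub>G\<^esub> e) = 3}"

definition nbr2 :: "('g, 'm) monoid_scheme \<Rightarrow> 'g set \<Rightarrow> 'g \<Rightarrow> 'g set"  \<comment> \<open>the set \<open>D\<^sub>d\<close>\<close>
  where "nbr2 G D d = {e \<in> D. group.ord G (d \<otimes>\<^bsub>G\<^esub> e) = 2}"

definition theta_rel :: "('g, 'm) monoid_scheme \<Rightarrow> 'g set \<Rightarrow> 'g \<Rightarrow> 'g \<Rightarrow> bool"
  where "theta_rel G D d e \<longleftrightarrow> d \<in> D \<and> e \<in> D \<and> nbr2 G D d = nbr2 G D e"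

definition theta_subgroup :: "('g, 'm) monoid_scheme \<Rightarrow> 'g set \<Rightarrow> 'g set"
  where "theta_subgroup G D = generate G {d \<otimes>\<^bsub>G\<^esub> e |d e. theta_rel G D d e}"

definition hat_group :: "('g, 'm) monoid_scheme \<Rightarrow> 'g set \<Rightarrow> 'g set monoid"
  where "hat_group G D = G Mod theta_subgroup G D"

text \<open>In \<^term>\<open>G Mod N\<close> the elements are right cosets; as \<open>\<theta>(G)\<close> is normal,
  left and right cosets coincide.\<close>

definition hat_set :: "('g, 'm) monoid_scheme \<Rightarrow> 'g set \<Rightarrow> 'g set set"
  where "hat_set G D = (\<lambda>d. theta_subgroup G D #>\<^bsub>G\<^esub> d) ` D"

text \<open>The situation written \<open>G = 3\<^sup>\<bullet>\<^sup>hH\<close> with \<open>H = G/\<theta>(G)\<close>; as \<open>D\<close> is nonempty in the connected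
  case, this determines the number \<open>h\<close>.\<close>

definition three_bullet :: "('g, 'm) monoid_scheme \<Rightarrow> 'g set \<Rightarrow> nat \<Rightarrow> bool"
  where "three_bullet G D h \<longleftrightarrow> theta_subgroup G D \<noteq> {\<one>\<^bsub>G\<^esub>} \<and> h \<ge> 1 \<and>
    (\<forall>d\<in>D. card (D \<inter> (d <#\<^bsub>G\<^esub> theta_subgroup G D)) = 3 ^ h)"


section \<open>The space underlying the Matsuo algebra\<close>

text \<open>Vectors are finitely supported functions. The product of the algebra (the only place
  where the parameter \<open>\<eta>\<close> enters) is not defined here; only the vector space and the
  collinearity map are.\<close>

definition vscale :: "'f::field \<Rightarrow> ('g \<Rightarrow>\<^sub>0 'f) \<Rightarrow> ('g \<Rightarrow>\<^sub>0 'f)"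
  where "vscale a v = Poly_Mapping.map ((*) a) v"

lemma lookup_vscale [simp]: "Poly_Mapping.lookup (vscale a v) x = a * Poly_Mapping.lookup v x"
  by (simp add: vscale_def Poly_Mapping.map.rep_eq when_def)

global_interpretation vs: vector_space "vscale :: 'f::field \<Rightarrow> ('g \<Rightarrow>\<^sub>0 'f) \<Rightarrow> _"
  defines vspan = vs.span and vdim = vs.dim
  by unfold_locales (auto intro!: poly_mapping_eqI simp: lookup_add algebra_simps)

definition basis_vec :: "'g \<Rightarrow> ('g \<Rightarrow>\<^sub>0 'f::field)"
  where "basis_vec d = Poly_Mapping.single d 1"

definition matsuo_space :: "'g set \<Rightarrow> ('g \<Rightarrow>\<^sub>0 'f::field) set"
  where "matsuo_space D = vspan (basis_vec ` D)"

definition collinearity_map ::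
    "('g, 'm) monoid_scheme \<Rightarrow> 'g set \<Rightarrow> ('g \<Rightarrow>\<^sub>0 'f::field) \<Rightarrow> ('g \<Rightarrow>\<^sub>0 'f)"
  where "collinearity_map G D v =
    (\<Sum>d\<in>D. vscale (Poly_Mapping.lookup v d) (\<Sum>c\<in>nbr3 G D d. basis_vec c))"

lemma collinearity_map_basis:
  assumes "finite D" "d \<in> D"
  shows "collinearity_map G D (basis_vec d) = (\<Sum>c\<in>nbr3 G D d. basis_vec c)"
proof -
  have "collinearity_map G D (basis_vec d) =
      (\<Sum>e\<in>D. if e = d then (\<Sum>c\<in>nbr3 G D e. basis_vec c) else 0)"
    unfolding collinearity_map_def
    by (intro sum.cong) (auto intro: poly_mapping_eqI simp: basis_vec_def lookup_single when_def)
  with assms show ?thesis by simp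
qed

lemma collinearity_map_linear:
  "Vector_Spaces.linear vscale vscale (collinearity_map G D)"
  by unfold_locales
    (auto simp: collinearity_map_def lookup_add vs.scale_left_distrib sum.distrib
      vs.scale_sum_right)

lemma collinearity_map_closed:
  "collinearity_map G D v \<in> matsuo_space D"
proof -
  have "basis_vec c \<in> vspan (basis_vec ` D)" if "c \<in> nbr3 G D d" for c d
    using that by (auto simp: nbr3_def intro: vs.span_base)
  then show ?thesis
    unfolding collinearity_map_def matsuo_space_def
    by (intro vs.span_sum vs.span_scale) auto
qed

lemma independent_basis_vec: "vs.independent (basis_vec ` D :: ('g \<Rightarrow>\<^sub>0 'f::field) set)"
proof
  let ?B = "basis_vec ` D :: ('g \<Rightarrow>\<^sub>0 'f) set"
  assume "vs.dependent ?B"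
  then obtain T :: "('g \<Rightarrow>\<^sub>0 'f) set" and u where T: "finite T" "T \<subseteq> ?B"
    and s: "(\<Sum>v\<in>T. vscale (u v) v) = 0" and nz: "\<exists>v\<in>T. u v \<noteq> 0"
    unfolding vs.dependent_explicit by blast
  from nz T obtain d where d: "basis_vec d \<in> T" "u (basis_vec d) \<noteq> 0" by blast
  have "Poly_Mapping.lookup (\<Sum>v\<in>T. vscale (u v) v) d =
      (\<Sum>v\<in>T. if v = basis_vec d then u v else 0)"
    unfolding lookup_sum
  proof (rule sum.cong)
    fix v assume "v \<in> T"
    with T(2) obtain c where "v = basis_vec c" by blast
    moreover have "basis_vec c = (basis_vec d :: 'g \<Rightarrow>\<^sub>0 'f) \<longleftrightarrow> c = d"
      by (metis basis_vec_def lookup_single_eq lookup_single_not_eq zero_neq_one)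
    ultimately show "Poly_Mapping.lookup (vscale (u v) v) d = (if v = basis_vec d then u v else 0)"
      by (simp add: basis_vec_def lookup_single when_def)
  qed simp
  also have "\<dots> = u (basis_vec d)" using T(1) d(1) by simp
  finally show False using d(2) s by simp
qed

definition theta_space :: "('g, 'm) monoid_scheme \<Rightarrow> 'g set \<Rightarrow> ('g \<Rightarrow>\<^sub>0 'f::field) set"  \<comment> \<open>the subspace \<open>U\<close>\<close>
  where "theta_space G D = vspan {basis_vec c - basis_vec d |c d. theta_rel G D c d}"


section \<open>Eigenvalues and multiplicities\<close>

definition eigenspace_on ::
    "(('g \<Rightarrow>\<^sub>0 'f::field) \<Rightarrow> ('g \<Rightarrow>\<^sub>0 'f)) \<Rightarrow> ('g \<Rightarrow>\<^sub>0 'f) set \<Rightarrow> 'f \<Rightarrow> ('g \<Rightarrow>\<^sub>0 'f) set"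
  where "eigenspace_on T M r = {v \<in> M. T v = vscale r v}"

definition is_eigenvalue ::
    "(('g \<Rightarrow>\<^sub>0 'f::field) \<Rightarrow> ('g \<Rightarrow>\<^sub>0 'f)) \<Rightarrow> ('g \<Rightarrow>\<^sub>0 'f) set \<Rightarrow> 'f \<Rightarrow> bool"
  where "is_eigenvalue T M r \<longleftrightarrow> (\<exists>v\<in>M. v \<noteq> 0 \<and> T v = vscale r v)"

text \<open>Multiplicity is geometric. For collinearity maps in characteristic 0 it agrees with the
  algebraic one: the matrix is symmetric with integer entries, hence diagonalizable over an
  algebraic closure.\<close>

definition multiplicity_on ::
    "(('g \<Rightarrow>\<^sub>0 'f::field) \<Rightarrow> ('g \<Rightarrow>\<^sub>0 'f)) \<Rightarrow> ('g \<Rightarrow>\<^sub>0 'f) set \<Rightarrow> 'f \<Rightarrow> nat"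
  where "multiplicity_on T M r = vdim (eigenspace_on T M r)"

end

theory Submission
  imports Defs
begin

text \<open>The value of \<open>(t + 1) v\<close> at \<open>x\<close> is the sum of \<open>v\<close> over \<open>D - D\<^sub>x\<close>, so it depends only
  on the \<open>\<theta>\<close>-class of \<open>x\<close>. Hence \<open>t = -1\<close> on \<open>U\<close>, every eigenvector for an eigenvalue other than \<open>-1\<close>
  is constant on \<open>\<theta>\<close>-classes, and on such vectors \<open>t\<close> acts as \<open>3\<^sup>h t' + 3\<^sup>h - 1\<close> with \<open>t'\<close> the
  collinearity map of the quotient.

  What remains is that \<open>-1\<close> is not an eigenvalue of \<open>t'\<close>, that is, no nonzero \<open>v\<close> which is constant on
  \<open>\<theta>\<close>-classes has \<open>(t + 1) v = 0\<close>. For such \<open>v\<close> the sums over all \<open>D\<^sub>x\<close> vanish. Averaging over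
  the centralizer of a point \<open>d\<close> gives \<open>\<phi>\<close> with \<open>\<phi>(d) \<noteq> 0\<close> if \<open>v(d) \<noteq> 0\<close>; it is constant on the
  collinearity components of \<open>D\<^sub>d\<close>, and \<open>\<phi>(x) = \<phi>(y)\<close> for commuting \<open>x, y \<in> A\<^sub>d\<close>. Peeling off
  the components of \<open>D\<^sub>d\<close> in the order of decreasing size shows that \<open>\<phi>\<close> vanishes on \<open>D\<^sub>d\<close>, then on
  the part of \<open>A\<^sub>d\<close> outside the class of \<open>d\<close>, and finally at \<open>d\<close>.\<close>

section \<open>Vertex transitive graphs\<close>

text \<open>Abstracts the graph on \<open>D\<close> in which distinct commuting points are adjacent;
  conjugations supply the automorphisms.\<close>

locale vertex_transitive_graph =
  fixes V :: "'a set" and N :: "'a \<Rightarrow> 'a set"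
  assumes finite_V: "finite V"
    and N_sub: "x \<in> V \<Longrightarrow> N x \<subseteq> V"
    and N_sym: "\<lbrakk>x \<in> V; y \<in> N x\<rbrakk> \<Longrightarrow> x \<in> N y"
    and N_irrefl: "x \<notin> N x"
    and automorphism: "\<lbrakk>x \<in> V; y \<in> V\<rbrakk> \<Longrightarrow>
      \<exists>\<sigma>. bij_betw \<sigma> V V \<and> \<sigma> x = y \<and> (\<forall>u\<in>V. N (\<sigma> u) = \<sigma> ` N u)"
begin

section \<open>Components of the complement graph inside a neighbourhood\<close>

definition link :: "'a \<Rightarrow> ('a \<times> 'a) set"
  where "link z = {(a, b). a \<in> N z \<and> b \<in> N z \<and> b \<notin> N a}"

text \<open>For commuting points the complement relation is collinearity, so for \<open>e\<close> in
  \<open>N z\<close> these are the collinearity components of the neighbourhood.\<close>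

definition comp :: "'a \<Rightarrow> 'a \<Rightarrow> 'a set"
  where "comp z e = {f. (e, f) \<in> (link z)\<^sup>*}"

lemma finite_N: "x \<in> V \<Longrightarrow> finite (N x)"
  using N_sub finite_V finite_subset by blast

lemma comp_refl: "e \<in> comp z e"
  by (simp add: comp_def)

lemma comp_sub: assumes "e \<in> N z" shows "comp z e \<subseteq> N z"
proof
  fix f assume "f \<in> comp z e"
  then have "(e, f) \<in> (link z)\<^sup>*" by (simp add: comp_def)
  then show "f \<in> N z" using assms by induction (auto simp: link_def)
qed

lemma link_sym: assumes "z \<in> V" shows "sym (link z)"
proof (rule symI)
  fix a b assume "(a, b) \<in> link z"
  moreover then have "a \<in> V" "b \<in> V" using N_sub[OF assms] by (auto simp: link_def)
  ultimately show "(b, a) \<in> link z" using N_sym[of b a] by (auto simp: link_def)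
qed

lemma comp_eq: assumes "z \<in> V" "f \<in> comp z e" shows "comp z f = comp z e"
proof -
  have ef: "(e, f) \<in> (link z)\<^sup>*" using assms by (simp add: comp_def)
  then have "(f, e) \<in> (link z)\<^sup>*" using sym_rtrancl[OF link_sym[OF assms(1)]] by (meson symD)
  with ef show ?thesis unfolding comp_def by (auto intro: rtrancl_trans)
qed

lemma comp_step: "\<lbrakk>f \<in> comp z e; f \<in> N z; g \<in> N z; g \<notin> N f\<rbrakk> \<Longrightarrow> g \<in> comp z e"
  unfolding comp_def link_def by (auto intro: rtrancl.rtrancl_into_rtrancl)

text \<open>The link relation depends on its base point only through membership in the
  neighbourhood, so a path inside \<open>comp z e\<close> is also a path at
  \<open>z'\<close>.\<close>

lemma comp_mono:
  assumes "e \<in> N z" "comp z e \<subseteq> N z'"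
  shows "comp z e \<subseteq> comp z' e"
proof
  fix f assume "f \<in> comp z e"
  then have "(e, f) \<in> (link z)\<^sup>*" by (simp add: comp_def)
  then show "f \<in> comp z' e"
  proof induction
    case base show ?case by (rule comp_refl)
  next
    case (step a b)
    have "a \<in> comp z e" "b \<in> comp z e"
      using step.hyps by (auto simp: comp_def intro: rtrancl.rtrancl_into_rtrancl)
    with assms(2) step show ?case by (intro comp_step[OF step.IH]) (auto simp: link_def)
  qed
qed

text \<open>Every step of a path at the image pulls back: neighbours of \<open>\<sigma> z\<close>
  are images, and adjacent preimages would have adjacent images.\<close>

lemma comp_image:
  assumes z: "z \<in> V" and e: "e \<in> N z" and \<sigma>: "\<forall>u\<in>V. N (\<sigma> u) = \<sigma> ` N u"
  shows "comp (\<sigma> z) (\<sigma> e) \<subseteq> \<sigma> ` comp z e"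
proof
  fix f assume "f \<in> comp (\<sigma> z) (\<sigma> e)"
  then have "(\<sigma> e, f) \<in> (link (\<sigma> z))\<^sup>*" by (simp add: comp_def)
  then show "f \<in> \<sigma> ` comp z e"
  proof induction
    case base show ?case by (simp add: comp_refl)
  next
    case (step a b)
    from step.IH obtain a' where a': "a = \<sigma> a'" "a' \<in> comp z e" by blast
    have a'N: "a' \<in> N z" using comp_sub[OF e] a' by blast
    then have "a' \<in> V" using N_sub z by blast
    from step.hyps(2) \<sigma> z obtain b' where b': "b = \<sigma> b'" "b' \<in> N z" by (auto simp: link_def)
    have "b' \<notin> N a'" using step.hyps(2) \<sigma> \<open>a' \<in> V\<close> a' b' by (auto simp: link_def)
    then show ?case using comp_step[OF a'(2) a'N b'(2)] b' by blast
  qed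
qed

lemma card_comp_image_le:
  assumes "z \<in> V" "e \<in> N z" "\<forall>u\<in>V. N (\<sigma> u) = \<sigma> ` N u"
  shows "card (comp (\<sigma> z) (\<sigma> e)) \<le> card (comp z e)"
proof -
  have "finite (comp z e)" using comp_sub finite_N assms finite_subset by blast
  then show ?thesis
    using card_mono[OF _ comp_image[OF assms]] card_image_le le_trans by blast
qed

text \<open>If the components meeting \<open>Y\<close> lie in \<open>Y\<close>, the cardinality is
  \<open>n\<close> times the number of components of size \<open>n\<close>. Equality of these
  cardinalities for two base points thus says that component sizes occur equally often at
  both.\<close>

definition comps_of_size :: "'a set \<Rightarrow> 'a \<Rightarrow> nat \<Rightarrow> 'a set"
  where "comps_of_size Y z n = {e \<in> N z \<inter> Y. card (comp z e) = n}"

text \<open>An automorphism moving \<open>x\<close> to \<open>y\<close> does not increase component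
  sizes, and neither does its inverse \<open>\<tau>\<close>, so sizes are preserved exactly.\<close>

lemma comps_of_size_le:
  assumes "x \<in> V" "y \<in> V"
  shows "card (comps_of_size V x n) \<le> card (comps_of_size V y n)"
proof -
  obtain \<sigma> where \<sigma>: "bij_betw \<sigma> V V" "\<sigma> x = y" "\<forall>u\<in>V. N (\<sigma> u) = \<sigma> ` N u"
    using automorphism[OF assms] by blast
  define \<tau> where "\<tau> = the_inv_into V \<sigma>"
  have inj: "inj_on \<sigma> V" and im: "\<sigma> ` V = V" using \<sigma>(1) by (auto simp: bij_betw_def)
  have \<tau>V: "\<tau> u \<in> V" if "u \<in> V" for u
    using that inj im by (metis \<tau>_def the_inv_into_into order_refl)
  have \<sigma>\<tau>: "\<sigma> (\<tau> u) = u" if "u \<in> V" for u using that inj im by (simp add: \<tau>_def f_the_inv_into_f)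
  have \<tau>\<sigma>: "\<tau> (\<sigma> u) = u" if "u \<in> V" for u using that inj by (simp add: \<tau>_def the_inv_into_f_f)
  have \<tau>N: "\<forall>u\<in>V. N (\<tau> u) = \<tau> ` N u"
  proof
    fix u assume u: "u \<in> V"
    have "N u = \<sigma> ` N (\<tau> u)" using \<sigma>(3) \<sigma>\<tau>[OF u] \<tau>V[OF u] by metis
    then have "\<tau> ` N u = (\<lambda>w. \<tau> (\<sigma> w)) ` N (\<tau> u)" by (simp add: image_image)
    also have "\<dots> = N (\<tau> u)" using \<tau>\<sigma> N_sub[OF \<tau>V[OF u]] by (auto simp: subset_iff image_iff)
    finally show "N (\<tau> u) = \<tau> ` N u" ..
  qed
  have "\<sigma> ` comps_of_size V x n \<subseteq> comps_of_size V y n"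
  proof
    fix f assume "f \<in> \<sigma> ` comps_of_size V x n"
    then obtain e where e: "f = \<sigma> e" "e \<in> N x" "e \<in> V" "card (comp x e) = n"
      by (auto simp: comps_of_size_def)
    have f: "f \<in> N y" "f \<in> V" using e \<sigma> assms im by auto
    have "card (comp y f) \<le> card (comp x e)" using card_comp_image_le[OF assms(1) e(2) \<sigma>(3)] e \<sigma> by simp
    moreover have "card (comp x e) \<le> card (comp y f)"
      using card_comp_image_le[OF assms(2) f(1) \<tau>N] e \<tau>\<sigma> \<sigma>(2) assms by metis
    ultimately show "f \<in> comps_of_size V y n" using f e by (simp add: comps_of_size_def)
  qed
  moreover have "inj_on \<sigma> (comps_of_size V x n)"
    using inj by (rule inj_on_subset) (auto simp: comps_of_size_def)
  moreover have "finite (comps_of_size V y n)"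
    using finite_V by (auto simp: comps_of_size_def)
  ultimately show ?thesis using card_inj_on_le by blast
qed

lemma card_N_eq:
  assumes "x \<in> V" "y \<in> V" shows "card (N x) = card (N y)"
proof -
  have "card (N x) \<le> card (N y)" if xy: "x \<in> V" "y \<in> V" for x y
  proof -
    obtain \<tau> where \<tau>: "\<tau> y = x" "\<forall>u\<in>V. N (\<tau> u) = \<tau> ` N u"
      using automorphism[OF xy(2,1)] by blast
    have "card (N x) = card (\<tau> ` N y)" using \<tau> xy by metis
    also have "\<dots> \<le> card (N y)" using card_image_le finite_N xy by blast
    finally show ?thesis .
  qed
  with assms show ?thesis by (simp add: le_antisym)
qed

text \<open>In the induction, \<open>Y\<close> is a set containing the support of \<open>\<phi>\<close>, and \<open>X\<close> is a largest component of
  \<open>N d\<close> inside \<open>Y\<close>; by the condition on sizes it is a whole component of \<open>N z\<close> for each of the points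
  \<open>z \<in> Z\<close> adjacent to all of \<open>X\<close>. So no point of \<open>W\<close> is adjacent to one of \<open>Z\<close>. The sums of \<open>\<phi>\<close> over
  the neighbourhoods of points of \<open>Z\<close>, \<open>W\<close> and \<open>X\<close> give the value \<open>a\<close> of \<open>\<phi>\<close> on \<open>X\<close> a negative
  rational coefficient \<open>K\<close> with \<open>K a = 0\<close>, and \<open>Z\<close> replaces \<open>Y\<close>. Working with rational multiples
  of \<open>a\<close> is what makes an order on the field unnecessary.\<close>

lemma vanish_on_N:
  fixes \<phi> :: "'a \<Rightarrow> 'f::field_char_0"
  assumes d: "d \<in> V"
    and harm: "\<And>x. x \<in> V \<Longrightarrow> (\<Sum>y\<in>N x. \<phi> y) = 0"
    and const_N: "\<And>e f. \<lbrakk>e \<in> N d; f \<in> N d; f \<notin> N e\<rbrakk> \<Longrightarrow> \<phi> e = \<phi> f"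
    and const_A: "\<And>w y. \<lbrakk>w \<in> V - N d - {d}; y \<in> V - N d - {d}; y \<in> N w\<rbrakk> \<Longrightarrow> \<phi> y = \<phi> w"
  shows "\<lbrakk>Y \<subseteq> V; d \<in> Y; \<And>x. x \<in> V - Y \<Longrightarrow> \<phi> x = 0;
      \<And>z e. \<lbrakk>z \<in> Y; e \<in> N z \<inter> Y\<rbrakk> \<Longrightarrow> comp z e \<subseteq> Y;
      \<And>z n. z \<in> Y \<Longrightarrow> card (comps_of_size Y z n) = card (comps_of_size Y d n);
      \<And>z. z \<in> Y \<Longrightarrow> card (N z \<inter> Y) = card (N d \<inter> Y); x \<in> N d\<rbrakk> \<Longrightarrow> \<phi> x = 0"
proof (induction "card Y" arbitrary: Y rule: less_induct)
  case less
  note Y = less.prems(1) and dY = less.prems(2) and supp = less.prems(3) and closed = less.prems(4)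
    and sizes = less.prems(5) and valency = less.prems(6)
  have xV: "x \<in> V" using less.prems(7) N_sub d by blast
  have finY: "finite Y" using Y finite_V finite_subset by blast
  show ?case
  proof (cases "N d \<inter> Y = {}")
    case True
    then show ?thesis using supp xV less.prems(7) by blast
  next
    case False
    have "finite (N d \<inter> Y)" using finY by blast
    then obtain e where e: "e \<in> N d \<inter> Y"
      and "card (comp d e) = Max ((\<lambda>f. card (comp d f)) ` (N d \<inter> Y))"
      using obtains_MAX[OF _ False] by metis
    then have emax: "card (comp d f) \<le> card (comp d e)" if "f \<in> N d \<inter> Y" for f
      using that \<open>finite (N d \<inter> Y)\<close> by simp
    define X where "X = comp d e"
    have X_Nd: "X \<subseteq> N d" and XY: "X \<subseteq> Y" and eX: "e \<in> X"
      using comp_sub closed[OF dY] e comp_refl by (auto simp: X_def)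
    have XV: "X \<subseteq> V" using XY Y by blast
    have finX: "finite X" using XY finY finite_subset by blast
    \<comment> \<open>By the equality of the counts, a size that occurs at \<open>z\<close> occurs
      at \<open>d\<close> as well, so the bound at \<open>d\<close> holds everywhere.\<close>
    have maximal: "card (comp z f) \<le> card X" if z: "z \<in> Y" "f \<in> N z \<inter> Y" for z f
    proof -
      have "finite (comps_of_size Y z (card (comp z f)))" using finY by (simp add: comps_of_size_def)
      moreover have "f \<in> comps_of_size Y z (card (comp z f))" using z by (simp add: comps_of_size_def)
      ultimately have "card (comps_of_size Y z (card (comp z f))) \<noteq> 0" by auto
      then have "card (comps_of_size Y d (card (comp z f))) \<noteq> 0" using sizes z by simp
      then obtain f' where "f' \<in> comps_of_size Y d (card (comp z f))"
        by (metis card.empty equals0I)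
      then show ?thesis using emax[of f'] by (auto simp: comps_of_size_def X_def)
    qed
    define Z where "Z = {z \<in> Y. X \<subseteq> N z}"
    define W where "W = Y - X - Z"
    have ZY: "Z \<subseteq> Y" and dZ: "d \<in> Z" using dY X_Nd by (auto simp: Z_def)
    have ZV: "Z \<subseteq> V" using ZY Y by blast
    have finZ: "finite Z" using ZY finY finite_subset by blast
    have XZ: "X \<inter> Z = {}" using N_irrefl by (auto simp: Z_def)
    \<comment> \<open>\<open>X\<close> is connected inside \<open>N z\<close>, hence part of one
      component there; maximality excludes a larger one.\<close>
    have comp_Z: "comp z e = X" if z: "z \<in> Z" for z
    proof -
      have ez: "e \<in> N z \<inter> Y" using z eX e by (auto simp: Z_def)
      have "X \<subseteq> comp z e" using comp_mono[of e d z] e z by (auto simp: X_def Z_def)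
      moreover have "finite (comp z e)"
        using closed[of z e] z ez ZY finY by (meson subsetD finite_subset)
      ultimately show ?thesis using maximal[of z e] z ez ZY by (metis card_seteq subsetD)
    qed
    \<comment> \<open>If some \<open>g\<close> in \<open>X\<close> were not adjacent to
      \<open>f\<close>, the link at \<open>z\<close> would put \<open>f\<close> into the component
      \<open>X\<close>.\<close>
    have N_in: "f \<in> Z" if z: "z \<in> Z" and f: "f \<in> N z" "f \<in> Y" "f \<notin> X" for z f
    proof -
      have "g \<in> N f" if g: "g \<in> X" for g
      proof (rule ccontr)
        assume *: "g \<notin> N f"
        have "f \<notin> N g" using * N_sym[of g f] g XV by blast
        moreover have "g \<in> N z" using g z by (auto simp: Z_def)
        ultimately have "f \<in> comp z e" using comp_step[of g z e f] g f comp_Z[OF z] by simp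
        then show False using f comp_Z[OF z] by simp
      qed
      then show ?thesis using f by (auto simp: Z_def)
    qed
    have split_Z: "N z \<inter> Y = X \<union> (N z \<inter> Z)" if "z \<in> Z" for z
      using that N_in XY ZY by (auto simp: Z_def)
    have NX: "Z \<subseteq> N g" if "g \<in> X" for g
      using that N_sym ZV by (auto simp: Z_def)
    have W_Z: "N w \<inter> Z = {}" if w: "w \<in> W" for w
    proof (rule ccontr)
      assume "N w \<inter> Z \<noteq> {}"
      then obtain z where z: "z \<in> N w" "z \<in> Z" by blast
      then have "w \<in> N z" using N_sym w Y by (auto simp: W_def)
      then show False using N_in[OF z(2)] w by (auto simp: W_def)
    qed
    have closed': "comp z f \<subseteq> Z" if z: "z \<in> Z" "f \<in> N z \<inter> Z" for z f
    proof
      fix g assume g: "g \<in> comp z f"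
      have zV: "z \<in> V" using z ZV by blast
      have gN: "g \<in> N z" using g comp_sub z by blast
      have gY: "g \<in> Y" using g closed[of z f] z ZY by blast
      have "g \<notin> X"
      proof
        assume "g \<in> X"
        then have "comp z g = comp z e" using comp_eq[OF zV] comp_Z[OF z(1)] by metis
        moreover have "comp z g = comp z f" using comp_eq[OF zV g] .
        ultimately have "f \<in> X" using comp_refl[of f z] comp_Z[OF z(1)] by simp
        then show False using z XZ by blast
      qed
      then show "g \<in> Z" using N_in[OF z(1) gN gY] by blast
    qed
    \<comment> \<open>Passing from \<open>Y\<close> to \<open>Z\<close> removes exactly the
      component \<open>X\<close> at every \<open>z\<close> in \<open>Z\<close>, so equal counts stay
      equal.\<close>
    have sizes_split: "card (comps_of_size Y z n) =
        card (comps_of_size Z z n) + (if n = card X then card X else 0)" if z: "z \<in> Z" for z n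
    proof -
      have zV: "z \<in> V" using z ZV by blast
      have "comp z g = X" if "g \<in> X" for g
        using that comp_eq[OF zV, of g e] comp_Z[OF z] by simp
      then have "comps_of_size Y z n = comps_of_size Z z n \<union> (if n = card X then X else {})"
        using split_Z[OF z] by (auto simp: comps_of_size_def)
      moreover have "comps_of_size Z z n \<inter> (if n = card X then X else {}) = {}"
        using XZ by (auto simp: comps_of_size_def)
      moreover have "finite (comps_of_size Z z n)" using finZ by (simp add: comps_of_size_def)
      ultimately show ?thesis using finX by (simp add: card_Un_disjoint)
    qed
    have valency_split: "card (N z \<inter> Y) = card X + card (N z \<inter> Z)" if z: "z \<in> Z" for z
      unfolding split_Z[OF z] using XZ finX finZ by (intro card_Un_disjoint) auto
    define \<rho> where "\<rho> = card (N d \<inter> Z)"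
    have \<rho>: "card (N z \<inter> Z) = \<rho>" if z: "z \<in> Z" for z
    proof -
      have "card (N z \<inter> Y) = card (N d \<inter> Y)" using valency z ZY by blast
      then show ?thesis using valency_split[OF z] valency_split[OF dZ] by (simp add: \<rho>_def)
    qed
    have \<rho>_less: "\<rho> < card Z"
      unfolding \<rho>_def using N_irrefl dZ finZ by (intro psubset_card_mono) auto
    define a where "a = \<phi> e"
    have \<phi>X: "\<phi> g = a" if "g \<in> X" for g
    proof -
      have "(e, g) \<in> (link d)\<^sup>*" using that by (simp add: X_def comp_def)
      then show ?thesis
        by induction (auto simp: a_def link_def dest: const_N)
    qed
    have harm': "(\<Sum>y\<in>N x \<inter> Y. \<phi> y) = 0" if "x \<in> V" for x
    proof -
      have "(\<Sum>y\<in>N x \<inter> Y. \<phi> y) = (\<Sum>y\<in>N x. \<phi> y)"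
        using N_sub[OF that] supp finite_N[OF that] by (intro sum.mono_neutral_left) auto
      then show ?thesis using harm[OF that] by simp
    qed
    \<comment> \<open>The vanishing sums at all points of \<open>Z\<close> are added; double
      counting the adjacent pairs inside \<open>Z\<close> turns the inner part into
      \<open>\<rho>\<close> times the total over \<open>Z\<close>.\<close>
    have eq1: "of_nat (card Z * card X) * a + of_nat \<rho> * sum \<phi> Z = 0"
    proof -
      have "0 = (\<Sum>z\<in>Z. \<Sum>y\<in>N z \<inter> Y. \<phi> y)" using harm' ZV by (intro sum.neutral[symmetric]) auto
      also have "\<dots> = (\<Sum>z\<in>Z. of_nat (card X) * a + (\<Sum>y\<in>N z \<inter> Z. \<phi> y))"
      proof (rule sum.cong[OF refl])
        fix z assume z: "z \<in> Z"
        show "(\<Sum>y\<in>N z \<inter> Y. \<phi> y) = of_nat (card X) * a + (\<Sum>y\<in>N z \<inter> Z. \<phi> y)"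
          unfolding split_Z[OF z] using XZ finX finZ by (subst sum.union_disjoint) (auto simp: \<phi>X)
      qed
      also have "\<dots> = of_nat (card Z * card X) * a + (\<Sum>z\<in>Z. \<Sum>y\<in>N z \<inter> Z. \<phi> y)"
        by (simp add: sum.distrib mult.assoc)
      also have "(\<Sum>z\<in>Z. \<Sum>y\<in>N z \<inter> Z. \<phi> y) = (\<Sum>z\<in>Z. \<Sum>y\<in>{y \<in> Z. y \<in> N z}. \<phi> y)"
        by (intro sum.cong) auto
      also have "\<dots> = (\<Sum>y\<in>Z. \<Sum>z\<in>{z \<in> Z. y \<in> N z}. \<phi> y)"
        by (rule sum.swap_restrict[OF finZ finZ])
      also have "\<dots> = (\<Sum>y\<in>Z. of_nat \<rho> * \<phi> y)"
      proof (rule sum.cong[OF refl])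
        fix y assume y: "y \<in> Z"
        have "{z \<in> Z. y \<in> N z} = N y \<inter> Z" using y ZV N_sym by blast
        then show "(\<Sum>z\<in>{z \<in> Z. y \<in> N z}. \<phi> y) = of_nat \<rho> * \<phi> y" using \<rho>[OF y] by simp
      qed
      finally show ?thesis by (simp add: sum_distrib_left)
    qed
    \<comment> \<open>Neighbours of \<open>w\<close> in \<open>N d\<close> contribute only through
      \<open>X\<close>, and those outside \<open>N d\<close> all carry the value
      \<open>\<phi> w\<close>. Regularity and \<open>N w \<noteq> N d\<close> provide at least one
      of the latter, so the equation can be solved for \<open>\<phi> w\<close>.\<close>
    have \<phi>W: "\<exists>c. 0 \<le> c \<and> \<phi> w = - of_rat c * a" if w: "w \<in> W" for w
    proof -
      have wY: "w \<in> Y" and wV: "w \<in> V" using w Y by (auto simp: W_def)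
      have w_A: "w \<in> V - N d - {d}"
      proof -
        have "d \<notin> N w" using W_Z[OF w] dZ by blast
        then have "w \<notin> N d" using N_sym[OF d] by blast
        then show ?thesis using wV w dZ by (auto simp: W_def)
      qed
      have N_w: "N w \<inter> Y = (N w \<inter> X) \<union> ((N w \<inter> Y) - N d)"
        using split_Z[OF dZ] W_Z[OF w] X_Nd XY by blast
      define q where "q = card (N w - N d)"
      have "N w \<noteq> N d" using w X_Nd by (auto simp: W_def Z_def)
      moreover have "card (N w) = card (N d)" by (rule card_N_eq[OF wV d])
      ultimately have "\<not> N w \<subseteq> N d" using finite_N[OF d] card_subset_eq by blast
      then have "q \<noteq> 0" using finite_N[OF wV] by (auto simp: q_def)
      have "(\<Sum>y\<in>N w. \<phi> y) = (\<Sum>y\<in>N w \<inter> N d. \<phi> y) + (\<Sum>y\<in>N w - N d. \<phi> y)"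
        using finite_N[OF wV] by (simp add: sum.Int_Diff)
      also have "(\<Sum>y\<in>N w \<inter> N d. \<phi> y) = (\<Sum>y\<in>N w \<inter> X. \<phi> y)"
      proof (rule sum.mono_neutral_right)
        show "\<forall>i\<in>N w \<inter> N d - N w \<inter> X. \<phi> i = 0"
          using N_w split_Z[OF dZ] W_Z[OF w] supp N_sub[OF d] by blast
      qed (use finite_N[OF wV] X_Nd in auto)
      also have "\<dots> = of_nat (card (N w \<inter> X)) * a" by (simp add: \<phi>X)
      also have "(\<Sum>y\<in>N w - N d. \<phi> y) = (\<Sum>y\<in>N w - N d. \<phi> w)"
      proof (rule sum.cong[OF refl])
        fix y assume y: "y \<in> N w - N d"
        have "y \<noteq> d" using y W_Z[OF w] dZ by blast
        then show "\<phi> y = \<phi> w" using const_A[OF w_A, of y] y N_sub[OF wV] by blast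
      qed
      also have "\<dots> = of_nat q * \<phi> w" by (simp add: q_def)
      finally have "of_nat (card (N w \<inter> X)) * a + of_nat q * \<phi> w = 0" using harm[OF wV] by simp
      then have "\<phi> w = - of_rat (of_nat (card (N w \<inter> X)) / of_nat q) * a"
        using \<open>q \<noteq> 0\<close> by (simp add: of_rat_divide field_simps eq_neg_iff_add_eq_0)
      then show ?thesis by (intro exI[of _ "of_nat (card (N w \<inter> X)) / of_nat q"]) simp
    qed
    then obtain c where c: "\<And>w. w \<in> W \<Longrightarrow> 0 \<le> c w \<and> \<phi> w = - of_rat (c w) * a" by metis
    define C where "C = (\<Sum>w\<in>N e \<inter> W. c w)"
    have C: "0 \<le> C" unfolding C_def using c by (intro sum_nonneg) auto
    define \<alpha> where "\<alpha> = card (N e \<inter> X)"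
    have \<alpha>_less: "\<alpha> < card X"
      unfolding \<alpha>_def using N_irrefl eX finX by (intro psubset_card_mono) auto
    \<comment> \<open>The sum at \<open>e\<close>, a point of \<open>X\<close> adjacent to all of
      \<open>Z\<close>: a second equation in \<open>a\<close> and
      \<open>sum \<phi> Z\<close>.\<close>
    have eq2: "of_nat \<alpha> * a + sum \<phi> Z - of_rat C * a = 0"
    proof -
      have "N e \<inter> Y = (N e \<inter> X) \<union> (Z \<union> (N e \<inter> W))"
        using NX[OF eX] XY ZY by (auto simp: W_def)
      then have "0 = (\<Sum>y\<in>(N e \<inter> X) \<union> (Z \<union> (N e \<inter> W)). \<phi> y)"
        using harm'[of e] eX XV by auto
      also have "\<dots> = (\<Sum>y\<in>N e \<inter> X. \<phi> y) + (sum \<phi> Z + (\<Sum>y\<in>N e \<inter> W. \<phi> y))"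
        using finX finZ finY XZ by (subst sum.union_disjoint; (subst sum.union_disjoint)?) (auto simp: W_def)
      also have "(\<Sum>y\<in>N e \<inter> X. \<phi> y) = of_nat \<alpha> * a" by (simp add: \<phi>X \<alpha>_def)
      also have "(\<Sum>y\<in>N e \<inter> W. \<phi> y) = (\<Sum>y\<in>N e \<inter> W. - (of_rat (c y) * a))"
        using c by (intro sum.cong) auto
      also have "\<dots> = - of_rat C * a" by (simp add: C_def sum_negf sum_distrib_right of_rat_sum)
      finally show ?thesis by (simp add: algebra_simps)
    qed
    \<comment> \<open>Eliminating \<open>sum \<phi> Z\<close> between the two equations leaves
      \<open>K\<close> as the coefficient of \<open>a\<close>.\<close>
    define K where "K = of_nat \<rho> * (of_nat \<alpha> - C) - of_nat (card Z * card X)"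
    have "of_rat K * a = 0"
    proof -
      have "of_rat K * a = of_nat \<rho> * (of_nat \<alpha> * a + sum \<phi> Z - of_rat C * a)
          - (of_nat (card Z * card X) * a + of_nat \<rho> * sum \<phi> Z)"
        by (simp add: K_def of_rat_diff of_rat_mult of_rat_add algebra_simps)
      also have "\<dots> = 0" unfolding eq1 eq2 by simp
      finally show ?thesis .
    qed
    moreover have "K < 0"
    proof -
      have "of_nat \<rho> * (of_nat \<alpha> - C) \<le> of_nat \<rho> * of_nat \<alpha>"
        using C by (intro mult_left_mono) auto
      also have "\<dots> \<le> of_nat \<rho> * (of_nat (card X) :: rat)"
        using \<alpha>_less by (intro mult_left_mono) auto
      also have "\<dots> < of_nat (card Z) * (of_nat (card X) :: rat)"
        using \<alpha>_less \<rho>_less by (intro mult_strict_right_mono) auto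
      finally show ?thesis by (simp add: K_def)
    qed
    ultimately have a0: "a = 0" by simp
    \<comment> \<open>With \<open>a = 0\<close> the values on \<open>X\<close> and \<open>W\<close>
      vanish, so \<open>Z\<close> contains the support; it is smaller than \<open>Y\<close> because
      it misses \<open>e\<close>.\<close>
    show ?thesis
    proof (rule less.hyps)
      show "card Z < card Y" using eX XZ XY ZY finY by (intro psubset_card_mono) auto
      show "Z \<subseteq> V" "d \<in> Z" "x \<in> N d" by fact+
      show "\<phi> x = 0" if "x \<in> V - Z" for x
        using that supp \<phi>X c a0 by (cases "x \<in> Y"; cases "x \<in> X") (auto simp: W_def)
      show "comp z f \<subseteq> Z" if "z \<in> Z" "f \<in> N z \<inter> Z" for z f by (rule closed'[OF that])
      show "card (comps_of_size Z z n) = card (comps_of_size Z d n)" if "z \<in> Z" for z n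
        using sizes_split[OF that, of n] sizes_split[OF dZ, of n] sizes[of z n] that ZY by auto
      show "card (N z \<inter> Z) = card (N d \<inter> Z)" if "z \<in> Z" for z
        using \<rho>[OF that] \<rho>[OF dZ] by simp
    qed
  qed
qed

text \<open>Once \<open>\<phi>\<close> is zero on \<open>N d\<close>, the sum over
  \<open>N w\<close> for \<open>w\<close> not adjacent to \<open>d\<close> sees only points outside
  \<open>N d\<close>, all with value \<open>\<phi> w\<close>. At a neighbour \<open>e\<close> of
  \<open>d\<close> only the twins of \<open>d\<close> then remain, and \<open>d\<close> is one of
  them.\<close>

lemma harmonic_zero:
  fixes \<phi> :: "'a \<Rightarrow> 'f::field_char_0"
  assumes d: "d \<in> V" and ne: "N d \<noteq> {}"
    and harm: "\<And>x. x \<in> V \<Longrightarrow> (\<Sum>y\<in>N x. \<phi> y) = 0"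
    and const_N: "\<And>e f. \<lbrakk>e \<in> N d; f \<in> N d; f \<notin> N e\<rbrakk> \<Longrightarrow> \<phi> e = \<phi> f"
    and const_A: "\<And>w y. \<lbrakk>w \<in> V - N d - {d}; y \<in> V - N d - {d}; y \<in> N w\<rbrakk> \<Longrightarrow> \<phi> y = \<phi> w"
    and const_twin: "\<And>x. \<lbrakk>x \<in> V; N x = N d\<rbrakk> \<Longrightarrow> \<phi> x = \<phi> d"
  shows "\<phi> d = 0"
proof -
  \<comment> \<open>The induction starts with all of \<open>V\<close>, where transitivity supplies
    the conditions on sizes and valencies.\<close>
  have zero_N: "\<phi> x = 0" if "x \<in> N d" for x
  proof (rule vanish_on_N[OF d harm const_N const_A, where Y = V])
    show "comp z e \<subseteq> V" if "z \<in> V" "e \<in> N z \<inter> V" for z e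
      using comp_sub[of e z] N_sub[of z] that by blast
    show "card (comps_of_size V z n) = card (comps_of_size V d n)" if "z \<in> V" for z n
      using comps_of_size_le that d by (simp add: le_antisym)
    show "card (N z \<inter> V) = card (N d \<inter> V)" if "z \<in> V" for z
      using card_N_eq[OF that d] N_sub[OF that] N_sub[OF d] by (simp add: Int_absorb2)
  qed (use that d in auto)
  have zero_A: "\<phi> w = 0" if w: "w \<in> V - N d - {d}" "N w \<noteq> N d" for w
  proof -
    have wV: "w \<in> V" using w by blast
    have dw: "d \<notin> N w" using w N_sym[of w d] by blast
    have "0 = (\<Sum>y\<in>N w. \<phi> y)" using harm[OF wV] by simp
    also have "\<dots> = (\<Sum>y\<in>N w - N d. \<phi> y)"
      using finite_N[OF wV] zero_N by (intro sum.mono_neutral_right) auto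
    also have "\<dots> = (\<Sum>y\<in>N w - N d. \<phi> w)"
      using const_A[OF w(1)] N_sub[OF wV] dw by (intro sum.cong) auto
    finally have "of_nat (card (N w - N d)) * \<phi> w = 0" by simp
    moreover have "\<not> N w \<subseteq> N d"
      using w(2) card_N_eq[OF wV d] finite_N[OF d] card_subset_eq by blast
    then have "card (N w - N d) \<noteq> 0" using finite_N[OF wV] by auto
    ultimately show ?thesis by simp
  qed
  obtain e where e: "e \<in> N d" using ne by blast
  then have eV: "e \<in> V" using N_sub d by blast
  have de: "d \<in> N e" using N_sym[OF d e] .
  have "0 = (\<Sum>y\<in>N e. \<phi> y)" using harm[OF eV] by simp
  also have "\<dots> = (\<Sum>y\<in>{y \<in> N e. N y = N d}. \<phi> y)"
  proof (rule sum.mono_neutral_right)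
    show "\<forall>y\<in>N e - {y \<in> N e. N y = N d}. \<phi> y = 0"
      using zero_N zero_A N_sub[OF eV] by blast
  qed (use finite_N[OF eV] in auto)
  also have "\<dots> = (\<Sum>y\<in>{y \<in> N e. N y = N d}. \<phi> d)"
    using const_twin N_sub[OF eV] by (intro sum.cong) auto
  finally have "of_nat (card {y \<in> N e. N y = N d}) * \<phi> d = 0" by simp
  moreover have "card {y \<in> N e. N y = N d} \<noteq> 0" using finite_N[OF eV] de by auto
  ultimately show ?thesis by simp
qed

end

section \<open>3-transposition groups and the relation \<open>\<theta>\<close>\<close>

context three_transposition_group
begin

section \<open>The conjugation action of \<open>G\<close> on \<open>D\<close>\<close>

definition conjugate :: "'g \<Rightarrow> 'g \<Rightarrow> 'g"
  where "conjugate g x = g \<otimes> x \<otimes> inv g"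

lemma D_carrier [simp]: "d \<in> D \<Longrightarrow> d \<in> carrier G"
  using D_sub by blast

lemma finite_D: "finite D"
  using D_sub fin finite_subset by blast

lemma conjugate_closed [simp]:
  "\<lbrakk>g \<in> carrier G; x \<in> carrier G\<rbrakk> \<Longrightarrow> conjugate g x \<in> carrier G"
  by (simp add: conjugate_def)

lemma conjugate_D: "\<lbrakk>g \<in> carrier G; d \<in> D\<rbrakk> \<Longrightarrow> conjugate g d \<in> D"
  by (simp add: conjugate_def D_normal)

lemma conjugate_mult:
  "\<lbrakk>g \<in> carrier G; h \<in> carrier G; x \<in> carrier G\<rbrakk> \<Longrightarrow>
    conjugate (g \<otimes> h) x = conjugate g (conjugate h x)"
  by (simp add: conjugate_def inv_mult_group m_assoc)

lemma conjugate_one: "x \<in> carrier G \<Longrightarrow> conjugate \<one> x = x"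
  by (simp add: conjugate_def)

lemma conjugate_inv: "\<lbrakk>g \<in> carrier G; x \<in> carrier G\<rbrakk> \<Longrightarrow> conjugate (inv g) (conjugate g x) = x"
  using conjugate_mult[of "inv g" g x] by (simp add: conjugate_one)

lemma conjugate_inv': "\<lbrakk>g \<in> carrier G; x \<in> carrier G\<rbrakk> \<Longrightarrow> conjugate g (conjugate (inv g) x) = x"
  using conjugate_inv[of "inv g" x] by simp

lemma conjugate_hom:
  "\<lbrakk>g \<in> carrier G; x \<in> carrier G; y \<in> carrier G\<rbrakk> \<Longrightarrow>
    conjugate g (x \<otimes> y) = conjugate g x \<otimes> conjugate g y"
  by (simp add: conjugate_def m_assoc inv_solve_left)

lemma conjugate_eq_iff:
  "\<lbrakk>g \<in> carrier G; x \<in> carrier G; y \<in> carrier G\<rbrakk> \<Longrightarrow> conjugate g x = conjugate g y \<longleftrightarrow> x = y"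
  by (metis conjugate_inv)

lemma conjugate_fixed_iff:
  assumes "g \<in> carrier G" "x \<in> carrier G"
  shows "conjugate g x = x \<longleftrightarrow> g \<otimes> x = x \<otimes> g"
  using assms inv_solve_right'[of x "g \<otimes> x" g] by (simp add: conjugate_def)

lemmas conjugate_commuting = conjugate_fixed_iff[THEN iffD2]

lemma bij_conjugate: assumes "g \<in> carrier G" shows "bij_betw (conjugate g) D D"
  by (rule bij_betw_byWitness[where f' = "conjugate (inv g)"])
    (use assms conjugate_D conjugate_inv conjugate_inv' in auto)

section \<open>Orders of products: commuting and collinear pairs\<close>

lemma D_square: assumes "d \<in> D" shows "d \<otimes> d = \<one>"
  using pow_ord_eq_1[of d] D_involution[OF assms] assms by (simp add: numeral_2_eq_2)

lemma D_square_left: "\<lbrakk>d \<in> D; x \<in> carrier G\<rbrakk> \<Longrightarrow> d \<otimes> (d \<otimes> x) = x"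
  by (simp add: m_assoc[symmetric] D_square)

lemma D_inv: assumes "d \<in> D" shows "inv d = d"
  using D_square assms by (simp add: inv_equality)

lemma conjugate_by_D: "d \<in> D \<Longrightarrow> conjugate d x = d \<otimes> x \<otimes> d"
  by (simp add: conjugate_def D_inv)

lemma ord_prod_eq_1_iff:
  assumes "d \<in> D" "e \<in> D" shows "ord (d \<otimes> e) = 1 \<longleftrightarrow> d = e"
proof -
  have "d \<otimes> e = \<one> \<longleftrightarrow> inv e = d" using assms inv_equality[of d e] l_inv[of e] by auto
  then show ?thesis using assms ord_eq_1[of "d \<otimes> e"] D_inv[of e] by auto
qed

lemma ord_prod_cases:
  assumes "d \<in> D" "e \<in> D" shows "ord (d \<otimes> e) \<in> {1, 2, 3}"
proof -
  have "ord (d \<otimes> e) \<ge> 1" using assms ord_ge_1[OF fin, of "d \<otimes> e"] by simp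
  then show ?thesis using D_three[OF assms] by auto
qed

text \<open>The order divides 2 exactly when \<open>d \<otimes> e\<close> is its own inverse, and
  that inverse is \<open>e \<otimes> d\<close>.\<close>

lemma ord_prod_eq_2_iff:
  assumes d: "d \<in> D" and e: "e \<in> D"
  shows "ord (d \<otimes> e) = 2 \<longleftrightarrow> e \<noteq> d \<and> d \<otimes> e = e \<otimes> d"
proof -
  have "(d \<otimes> e) [^] (2::nat) = \<one> \<longleftrightarrow> inv (d \<otimes> e) = d \<otimes> e"
    using d e inv_equality[of "d \<otimes> e" "d \<otimes> e"] by (simp add: numeral_2_eq_2) (metis D_carrier m_closed l_inv)
  also have "\<dots> \<longleftrightarrow> d \<otimes> e = e \<otimes> d" using d e by (auto simp: inv_mult_group D_inv)
  finally have "ord (d \<otimes> e) dvd 2 \<longleftrightarrow> d \<otimes> e = e \<otimes> d"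
    using pow_eq_id[of "d \<otimes> e" 2] d e by simp
  moreover have "ord (d \<otimes> e) dvd 2 \<longleftrightarrow> ord (d \<otimes> e) = 1 \<or> ord (d \<otimes> e) = 2"
    using ord_prod_cases[OF d e] by auto
  ultimately show ?thesis using ord_prod_eq_1_iff[OF d e] by auto
qed

lemma nbr2_iff: "d \<in> D \<Longrightarrow> e \<in> nbr2 G D d \<longleftrightarrow> e \<in> D \<and> e \<noteq> d \<and> d \<otimes> e = e \<otimes> d"
  using ord_prod_eq_2_iff by (auto simp: nbr2_def)

lemma nbr3_iff: "d \<in> D \<Longrightarrow> e \<in> nbr3 G D d \<longleftrightarrow> e \<in> D \<and> d \<otimes> e \<noteq> e \<otimes> d"
  using ord_prod_eq_2_iff[of d e] ord_prod_eq_1_iff[of d e] ord_prod_cases[of d e]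
  by (auto simp: nbr3_def)

lemma nbr2_conjugate: "\<lbrakk>d \<in> D; e \<in> nbr2 G D d\<rbrakk> \<Longrightarrow> conjugate e d = d"
  by (simp add: nbr2_iff conjugate_commuting)

lemma nbr3_eq: "d \<in> D \<Longrightarrow> nbr3 G D d = D - nbr2 G D d - {d}"
  by (auto simp: nbr2_iff nbr3_iff)

lemma nbr2_sub: "nbr2 G D d \<subseteq> D"
  by (auto simp: nbr2_def)

lemma nbr3_sub: "nbr3 G D d \<subseteq> D"
  by (auto simp: nbr3_def)

lemma nbr2_sym: "\<lbrakk>d \<in> D; e \<in> nbr2 G D d\<rbrakk> \<Longrightarrow> d \<in> nbr2 G D e"
  by (auto simp: nbr2_iff)

lemma nbr3_sym: "\<lbrakk>d \<in> D; e \<in> nbr3 G D d\<rbrakk> \<Longrightarrow> d \<in> nbr3 G D e"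
  by (auto simp: nbr3_iff)

lemma nbr2_irrefl: "d \<notin> nbr2 G D d"
  using ord_prod_eq_1_iff[of d d] by (auto simp: nbr2_def)

text \<open>Order 3 makes \<open>ded\<close> the inverse of \<open>ede\<close>, and
  \<open>ede\<close> is its own inverse.\<close>

lemma braid:
  assumes d: "d \<in> D" and e: "e \<in> nbr3 G D d"
  shows "d \<otimes> (e \<otimes> d) = e \<otimes> (d \<otimes> e)"
proof -
  have eD: "e \<in> D" and "ord (d \<otimes> e) = 3" using e by (auto simp: nbr3_def)
  then have "(d \<otimes> e) [^] (3::nat) = \<one>" using pow_ord_eq_1[of "d \<otimes> e"] d by simp
  then have "(d \<otimes> (e \<otimes> d)) \<otimes> (e \<otimes> (d \<otimes> e)) = \<one>"
    using d eD by (simp add: numeral_3_eq_3 m_assoc)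
  then have "inv (e \<otimes> (d \<otimes> e)) = d \<otimes> (e \<otimes> d)"
    using d eD by (simp add: inv_equality)
  then show ?thesis using d eD by (simp add: inv_mult_group D_inv m_assoc)
qed

text \<open>Both sides are the third point of the line through \<open>d\<close> and
  \<open>e\<close>.\<close>

lemma conjugate_nbr3_commute:
  assumes "d \<in> D" "e \<in> nbr3 G D d" shows "conjugate d e = conjugate e d"
  using braid[OF assms] assms by (simp add: conjugate_by_D nbr3_iff m_assoc)

lemma conjugate_conjugate_D: "\<lbrakk>d \<in> D; x \<in> carrier G\<rbrakk> \<Longrightarrow> conjugate d (conjugate d x) = x"
  using conjugate_inv[of d x] by (simp add: D_inv)

lemma conjugate_prod_nbr3:
  assumes "d \<in> D" "e \<in> nbr3 G D d" shows "conjugate (d \<otimes> e) d = e"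
proof -
  have e: "e \<in> D" using assms nbr3_sub by blast
  have "conjugate (d \<otimes> e) d = conjugate d (conjugate e d)" using assms e by (simp add: conjugate_mult)
  also have "\<dots> = e"
    using assms e by (simp add: conjugate_nbr3_commute[OF assms, symmetric] conjugate_conjugate_D)
  finally show ?thesis .
qed

lemma conjugate_nbr2:
  assumes g: "g \<in> carrier G" and d: "d \<in> D"
  shows "nbr2 G D (conjugate g d) = conjugate g ` nbr2 G D d"
proof -
  have sub: "conjugate g ` nbr2 G D d \<subseteq> nbr2 G D (conjugate g d)"
    if g: "g \<in> carrier G" and d: "d \<in> D" for g d
    using that conjugate_D
    by (auto simp: nbr2_iff conjugate_eq_iff conjugate_hom[symmetric])
  have "nbr2 G D (conjugate g d) = conjugate g ` conjugate (inv g) ` nbr2 G D (conjugate g d)"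
    using g d nbr2_sub by (force simp: image_image conjugate_inv')
  also have "\<dots> \<subseteq> conjugate g ` nbr2 G D d"
    using sub[of "inv g" "conjugate g d"] g d conjugate_D[OF g d]
    by (intro image_mono) (simp add: conjugate_inv)
  finally show ?thesis using sub[OF g d] by blast
qed

text \<open>The Coxeter relations of type \<open>A\<^sub>3\<close>: \<open>x - d - y\<close> is conjugate in \<open>Sym(4)\<close> to
  \<open>(1 3), (1 2), (2 4)\<close>, and \<open>e\<close> is the transposition \<open>(3 4)\<close>.\<close>

lemma A3_relations:
  assumes d: "d \<in> D" and x: "x \<in> nbr3 G D d" and y: "y \<in> nbr3 G D d" and xy: "x \<otimes> y = y \<otimes> x"
  defines "e \<equiv> conjugate (x \<otimes> y) d"
  shows "e \<in> D" "d \<otimes> e = e \<otimes> d" "conjugate (d \<otimes> e) x = y"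
proof -
  have xD: "x \<in> D" and yD: "y \<in> D" using x y by (auto simp: nbr3_def)
  note [simp] = D_carrier[OF d] D_carrier[OF xD] D_carrier[OF yD]
  note [simp] = m_assoc D_square_left[OF d] D_square_left[OF xD] D_square_left[OF yD]
    D_square[OF d] D_square[OF xD] D_square[OF yD]
  note bx = braid[OF d x] and bry = braid[OF d y]
  \<comment> \<open>The relations followed by an arbitrary right factor, so that rewriting reaches
    the inside of right-nested products.\<close>
  have byL: "d \<otimes> (y \<otimes> (d \<otimes> z)) = y \<otimes> (d \<otimes> (y \<otimes> z))" if "z \<in> carrier G" for z
    using arg_cong[OF bry, of "\<lambda>t. t \<otimes> z"] that by simp
  have xyL: "x \<otimes> (y \<otimes> z) = y \<otimes> (x \<otimes> z)" if "z \<in> carrier G" for z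
    using arg_cong[OF xy, of "\<lambda>t. t \<otimes> z"] that by simp
  show eD: "e \<in> D" unfolding e_def by (rule conjugate_D) (use d in auto)
  have e1: "e = x \<otimes> (y \<otimes> (d \<otimes> (y \<otimes> x)))"
    by (simp add: e_def conjugate_def inv_mult_group D_inv xD yD)
  have e: "e = x \<otimes> (d \<otimes> (y \<otimes> (d \<otimes> x)))" unfolding e1 by (simp add: byL)
  have "d \<otimes> (e \<otimes> d) = (d \<otimes> (x \<otimes> d)) \<otimes> (y \<otimes> (d \<otimes> (x \<otimes> d)))" by (simp add: e)
  also have "\<dots> = x \<otimes> (d \<otimes> (x \<otimes> (y \<otimes> (x \<otimes> (d \<otimes> x)))))" unfolding bx by simp
  also have "x \<otimes> (y \<otimes> (x \<otimes> (d \<otimes> x))) = y \<otimes> (d \<otimes> x)" by (simp add: xyL)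
  finally have ded: "d \<otimes> (e \<otimes> d) = e" by (simp add: e)
  then have "d \<otimes> (d \<otimes> (e \<otimes> d)) = d \<otimes> e" by simp
  then show comm: "d \<otimes> e = e \<otimes> d" using eD by simp
  have "conjugate (d \<otimes> e) x = conjugate e (conjugate d x)"
    using comm eD by (simp add: conjugate_mult del: m_assoc)
  also have "conjugate d x = x \<otimes> (d \<otimes> x)" using bx d by (simp add: conjugate_by_D)
  also have "conjugate e (x \<otimes> (d \<otimes> x)) = x \<otimes> (d \<otimes> (y \<otimes> (d \<otimes> (y \<otimes> (d \<otimes> x)))))"
    using eD by (simp add: conjugate_by_D) (simp add: e)
  also have "d \<otimes> (y \<otimes> (d \<otimes> (y \<otimes> (d \<otimes> x)))) = y \<otimes> x" by (simp add: byL)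
  also have "x \<otimes> (y \<otimes> x) = y" by (simp add: xyL)
  finally show "conjugate (d \<otimes> e) x = y" .
qed

section \<open>The relation \<theta> and the subgroup it generates\<close>

lemma theta_refl: "x \<in> D \<Longrightarrow> theta_rel G D x x"
  by (simp add: theta_rel_def)

lemma theta_sym: "theta_rel G D x y \<Longrightarrow> theta_rel G D y x"
  by (simp add: theta_rel_def)

lemma theta_trans: "\<lbrakk>theta_rel G D x y; theta_rel G D y z\<rbrakk> \<Longrightarrow> theta_rel G D x z"
  by (simp add: theta_rel_def)

lemma theta_D: "theta_rel G D x y \<Longrightarrow> x \<in> D \<and> y \<in> D"
  by (simp add: theta_rel_def)

lemma theta_nbr2: "theta_rel G D x y \<Longrightarrow> nbr2 G D x = nbr2 G D y"
  by (simp add: theta_rel_def)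

lemma theta_conjugate:
  "\<lbrakk>theta_rel G D x y; g \<in> carrier G\<rbrakk> \<Longrightarrow> theta_rel G D (conjugate g x) (conjugate g y)"
  by (simp add: theta_rel_def conjugate_D conjugate_nbr2)

lemma theta_not_nbr2: "theta_rel G D x y \<Longrightarrow> y \<notin> nbr2 G D x"
  using nbr2_irrefl theta_nbr2 by blast

text \<open>If \<open>x\<close> commutes with \<open>a\<close>, it commutes with \<open>b\<close>
  and is fixed. Otherwise conjugating \<open>a\<close>, \<open>b\<close> by \<open>x\<close> gives
  the same points as conjugating \<open>x\<close> by \<open>a\<close>, \<open>b\<close>; these are
  therefore related, and applying \<open>a\<close> to both gives the claim.\<close>

lemma theta_conjugate_prod:
  assumes ab: "theta_rel G D a b" and x: "x \<in> D"
  shows "theta_rel G D x (conjugate (a \<otimes> b) x)"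
proof -
  have a: "a \<in> D" and b: "b \<in> D" using theta_D[OF ab] by auto
  have ab_x: "conjugate (a \<otimes> b) x = conjugate a (conjugate b x)"
    using a b x by (simp add: conjugate_mult)
  show ?thesis
  proof (cases "x \<in> nbr2 G D a")
    case True
    then have "x \<in> nbr2 G D b" using theta_nbr2[OF ab] by simp
    then have "conjugate a x = x" "conjugate b x = x"
      using True nbr2_conjugate[OF x] nbr2_sym[OF a] nbr2_sym[OF b] by blast+
    then show ?thesis using x ab_x theta_refl by simp
  next
    case notin: False
    have flip: "conjugate c x = conjugate x c" if "c \<in> {a, b}" for c
    proof (cases "c = x")
      case False
      then have "x \<in> nbr3 G D c" using notin that a b x theta_nbr2[OF ab] by (auto simp: nbr3_eq)
      then show ?thesis using conjugate_nbr3_commute that a b by blast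
    qed simp
    have "theta_rel G D (conjugate x a) (conjugate x b)" using theta_conjugate[OF ab] x by simp
    then have "theta_rel G D (conjugate a x) (conjugate b x)" using flip by simp
    then have "theta_rel G D (conjugate a (conjugate a x)) (conjugate a (conjugate b x))"
      using theta_conjugate a by simp
    then show ?thesis using conjugate_conjugate_D[OF a] x ab_x by simp
  qed
qed

lemma theta_subgroup_normal: "theta_subgroup G D \<lhd> G"
  unfolding theta_subgroup_def
proof (rule normal_generateI)
  show "{d \<otimes> e |d e. theta_rel G D d e} \<subseteq> carrier G" using theta_D by fastforce
  fix h g assume "h \<in> {d \<otimes> e |d e. theta_rel G D d e}" and g: "g \<in> carrier G"
  then obtain d e where de: "h = d \<otimes> e" "theta_rel G D d e" by blast
  then have "g \<otimes> h \<otimes> inv g = conjugate g d \<otimes> conjugate g e"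
    using conjugate_hom[of g d e] g theta_D[OF de(2)] by (simp add: conjugate_def)
  then show "g \<otimes> h \<otimes> inv g \<in> {d \<otimes> e |d e. theta_rel G D d e}"
    using theta_conjugate[OF de(2) g] by blast
qed

lemma theta_prod_mem: "theta_rel G D d e \<Longrightarrow> d \<otimes> e \<in> theta_subgroup G D"
  unfolding theta_subgroup_def by (auto intro: generate.incl)

lemma theta_subgroup_conjugate:
  assumes "n \<in> theta_subgroup G D" "x \<in> D"
  shows "theta_rel G D x (conjugate n x)"
  using assms(1)[unfolded theta_subgroup_def] assms(2)
proof (induction n arbitrary: x rule: generate.induct)
  case one
  then show ?case by (simp add: conjugate_one theta_refl)
next
  case (incl h)
  then show ?case using theta_conjugate_prod by blast
next
  case (inv h)
  then obtain d e where de: "h = d \<otimes> e" "theta_rel G D d e" by blast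
  then have "inv h = e \<otimes> d" using theta_D[OF de(2)] by (simp add: inv_mult_group D_inv)
  then show ?case using theta_conjugate_prod[OF theta_sym[OF de(2)] inv(2)] by simp
next
  case (eng h1 h2)
  have "{d \<otimes> e |d e. theta_rel G D d e} \<subseteq> carrier G" using theta_D by fastforce
  then have "h1 \<in> carrier G" "h2 \<in> carrier G"
    using eng.hyps generate_in_carrier by blast+
  moreover have "conjugate h2 x \<in> D" using calculation eng.prems conjugate_D by blast
  ultimately show ?case
    using eng theta_trans[OF eng.IH(2)[OF eng.prems] eng.IH(1)] by (simp add: conjugate_mult)
qed

end

section \<open>Transitivity, and recovering \<theta> from the subgroup it generates\<close>

context connected_three_transposition_group
begin

lemma conjugate_transitive:
  assumes "x \<in> D" "y \<in> D" shows "\<exists>g\<in>carrier G. conjugate g x = y"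
proof -
  obtain d where d: "d \<in> D" "D = {conjugate g d |g. g \<in> carrier G}"
    using D_class unfolding conjugate_def by (elim bexE)
  obtain g where g: "g \<in> carrier G" "x = conjugate g d"
    using subsetD[OF equalityD1[OF d(2)] assms(1)] by blast
  obtain h where h: "h \<in> carrier G" "y = conjugate h d"
    using subsetD[OF equalityD1[OF d(2)] assms(2)] by blast
  have "conjugate (h \<otimes> inv g) x = y" using g h d(1) by (simp add: conjugate_mult conjugate_inv)
  then show ?thesis using g(1) h(1) by blast
qed

sublocale commuting: vertex_transitive_graph D "nbr2 G D"
proof
  fix x y assume xy: "x \<in> D" "y \<in> D"
  obtain g where "g \<in> carrier G" "conjugate g x = y" using conjugate_transitive[OF xy] by blast
  then show "\<exists>\<sigma>. bij_betw \<sigma> D D \<and> \<sigma> x = y \<and> (\<forall>u\<in>D. nbr2 G D (\<sigma> u) = \<sigma> ` nbr2 G D u)"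
    using bij_conjugate conjugate_nbr2 by blast
qed (use finite_D nbr2_sub nbr2_sym nbr2_irrefl in auto)

text \<open>A point commuting with \<open>e\<close> commutes with \<open>conjugate d e\<close>,
  hence with \<open>d\<close>, the third point of their line. Since all neighbourhoods have the same
  size, the inclusion is an equality.\<close>

lemma theta_of_line:
  assumes d: "d \<in> D" and e: "e \<in> nbr3 G D d" and th: "theta_rel G D e (conjugate d e)"
  shows "theta_rel G D d e"
proof -
  have eD: "e \<in> D" using e nbr3_sub by blast
  have d_eq: "d = conjugate e (conjugate d e)"
    using conjugate_nbr3_commute[OF d e] conjugate_conjugate_D[OF eD] d by simp
  have "nbr2 G D e \<subseteq> nbr2 G D d"
  proof
    fix y assume y: "y \<in> nbr2 G D e"
    then have yD: "y \<in> D" by (simp add: nbr2_def)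
    have "conjugate y e = e" "conjugate y (conjugate d e) = conjugate d e"
      using nbr2_conjugate[OF eD y] nbr2_conjugate[of "conjugate d e" y] y theta_nbr2[OF th]
        theta_D[OF th] by simp_all
    then have "conjugate y (conjugate e (conjugate d e)) = conjugate e (conjugate d e)"
      using yD eD d by (simp add: conjugate_by_D[of e] conjugate_hom)
    then have "conjugate y d = d" using d_eq by metis
    then have "y \<otimes> d = d \<otimes> y" using yD d by (simp add: conjugate_fixed_iff)
    moreover have "y \<noteq> d" using y e eD d by (auto simp: nbr2_iff nbr3_iff)
    ultimately show "y \<in> nbr2 G D d" using d yD by (simp add: nbr2_iff)
  qed
  then have "nbr2 G D e = nbr2 G D d"
    using commuting.card_N_eq[OF eD d] commuting.finite_N[OF d] card_subset_eq by blast
  then show ?thesis using d eD by (simp add: theta_rel_def)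
qed

text \<open>This identifies the \<theta>-classes with the intersections of \<open>D\<close> with
  cosets of \<theta>(G). The tool is that \<open>d \<otimes> e\<close> keeps every point in its
  class; for collinear \<open>d\<close>, \<open>e\<close> it moves \<open>e\<close> along their
  line.\<close>

lemma theta_of_prod_mem:
  assumes d: "d \<in> D" and e: "e \<in> D" and de: "d \<otimes> e \<in> theta_subgroup G D"
  shows "theta_rel G D d e"
proof -
  have moves: "theta_rel G D x (conjugate (d \<otimes> e) x)" if "x \<in> D" for x
    using theta_subgroup_conjugate[OF de that] .
  consider "d = e" | "e \<in> nbr3 G D d" | "e \<in> nbr2 G D d" using d e by (auto simp: nbr3_eq)
  then show ?thesis
  proof cases
    case 1 then show ?thesis using d theta_refl by simp
  next
    case 2
    have "conjugate (d \<otimes> e) e = conjugate d e"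
      using d e by (simp add: conjugate_mult conjugate_commuting)
    then show ?thesis using theta_of_line[OF d 2] moves[OF e] by simp
  next
    case 3
    have comm: "d \<otimes> e = e \<otimes> d" and "e \<noteq> d" using 3 d by (auto simp: nbr2_iff)
    \<comment> \<open>If \<open>x\<close> were collinear with \<open>e\<close> too, its conjugate by
      \<open>d \<otimes> e\<close> would be related to \<open>x\<close> and commute with it, hence
      equal \<open>x\<close>, and the \<open>A\<^sub>3\<close> relations would force
      \<open>d = e\<close>. So \<open>e\<close> fixes \<open>x\<close>, and \<open>x\<close> is
      related to \<open>conjugate d x\<close>.\<close>
    have theta_A: "theta_rel G D d x" if x: "x \<in> nbr3 G D d" for x
    proof -
      have xD: "x \<in> D" using x nbr3_sub by blast
      have "x \<notin> nbr3 G D e"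
      proof
        assume xe: "x \<in> nbr3 G D e"
        define x' where "x' = conjugate (d \<otimes> e) x"
        note A3 = A3_relations[OF xD nbr3_sym[OF d x] nbr3_sym[OF e xe] comm, folded x'_def]
        have "theta_rel G D x x'" using moves[OF xD] by (simp add: x'_def)
        then have "x' \<notin> nbr2 G D x" by (rule theta_not_nbr2)
        then have "x' = x" using A3 xD by (auto simp: nbr2_iff)
        then have "d = e" using A3(3) xD d e D_square[OF xD] by (simp add: conjugate_one)
        then show False using \<open>e \<noteq> d\<close> by simp
      qed
      moreover have "x \<noteq> e" using 3 x d by (auto simp: nbr3_eq)
      ultimately have "conjugate e x = x" using xD e by (simp add: nbr3_iff conjugate_commuting)
      then have "conjugate (d \<otimes> e) x = conjugate d x" using d e xD by (simp add: conjugate_mult)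
      then show ?thesis using theta_of_line[OF d x] moves[OF xD] by simp
    qed
    \<comment> \<open>Now the class of \<open>d\<close> is closed under conjugation by generators,
      so by transitivity it contains \<open>e\<close>.\<close>
    have class_closed: "theta_rel G D d (conjugate y c)" if y: "y \<in> D" and c: "theta_rel G D d c" for y c
    proof (cases "y \<in> nbr2 G D d")
      case True
      then have "conjugate y c = c"
        using theta_nbr2[OF c] theta_D[OF c] nbr2_conjugate[of c y] by simp
      then show ?thesis using c by simp
    next
      case False
      then have "theta_rel G D d y" using y theta_A d theta_refl by (cases "y = d") (auto simp: nbr3_eq)
      then have cy: "theta_rel G D y c" using c theta_sym theta_trans by blast
      have "theta_rel G D (conjugate y y) (conjugate y c)" using theta_conjugate[OF cy] y by simp
      then have "theta_rel G D y (conjugate y c)" using y by (simp add: conjugate_commuting)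
      then show ?thesis using \<open>theta_rel G D d y\<close> theta_trans by blast
    qed
    have "theta_rel G D d (conjugate g c)" if "g \<in> generate G D" "theta_rel G D d c" for g c
      using that
    proof (induction g arbitrary: c rule: generate.induct)
      case one then show ?case using theta_D by (simp add: conjugate_one)
    next
      case (incl h) then show ?case using class_closed by blast
    next
      case (inv h) then show ?case using class_closed by (simp add: D_inv)
    next
      case (eng h1 h2)
      have "h1 \<in> carrier G" "h2 \<in> carrier G" using eng.hyps D_generates by auto
      then show ?case using eng theta_D[OF eng.prems] by (simp add: conjugate_mult)
    qed
    moreover obtain g where "g \<in> carrier G" "conjugate g d = e"
      using conjugate_transitive[OF d e] by blast
    ultimately show ?thesis using D_generates theta_refl[OF d] by metis
  qed
qed

section \<open>Vanishing of class-constant eigenvectors for -1\<close>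

lemma eigenvector_minus_one_zero:
  fixes v :: "'a \<Rightarrow> 'f::field_char_0"
  assumes v_theta: "\<And>x y. theta_rel G D x y \<Longrightarrow> v x = v y"
    and eig: "\<And>x. x \<in> D \<Longrightarrow> (\<Sum>y\<in>nbr3 G D x. v y) = - v x"
    and d: "d \<in> D"
  shows "v d = 0"
proof -
  define m where "m = card (nbr2 G D d)"
  have m: "card (nbr2 G D x) = m" if "x \<in> D" for x
    unfolding m_def by (rule commuting.card_N_eq[OF that d])
  \<comment> \<open>The eigenvalue equation says that the sum over \<open>D - D\<^sub>x\<close> is
    0.\<close>
  have sum_N: "(\<Sum>y\<in>nbr2 G D x. v y) = sum v D" if x: "x \<in> D" for x
  proof -
    have "D - {x} - nbr2 G D x = nbr3 G D x" using nbr3_eq[OF x] by blast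
    moreover have "sum v D = v x + sum v (D - {x})" using finite_D x by (rule sum.remove)
    moreover have "nbr2 G D x \<subseteq> D - {x}" using nbr2_sub nbr2_irrefl by blast
    then have "sum v (D - {x}) = sum v (D - {x} - nbr2 G D x) + sum v (nbr2 G D x)"
      using finite_D by (intro sum.subset_diff) auto
    ultimately have "sum v D = v x + ((\<Sum>y\<in>nbr3 G D x. v y) + (\<Sum>y\<in>nbr2 G D x. v y))"
      by simp
    then show ?thesis using eig[OF x] by simp
  qed
  \<comment> \<open>Summing over all \<open>x\<close> counts each \<open>v y\<close> exactly
    \<open>m\<close> times; as \<open>m < card D\<close>, the total must be 0.\<close>
  have "of_nat (card D) * sum v D = (\<Sum>x\<in>D. \<Sum>y\<in>nbr2 G D x. v y)" using sum_N by simp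
  also have "\<dots> = (\<Sum>x\<in>D. \<Sum>y\<in>{y \<in> D. y \<in> nbr2 G D x}. v y)"
    using nbr2_sub by (intro sum.cong) auto
  also have "\<dots> = (\<Sum>y\<in>D. \<Sum>x\<in>{x \<in> D. y \<in> nbr2 G D x}. v y)"
    by (rule sum.swap_restrict[OF finite_D finite_D])
  also have "\<dots> = (\<Sum>y\<in>D. of_nat m * v y)"
  proof (rule sum.cong[OF refl])
    fix y assume y: "y \<in> D"
    have "{x \<in> D. y \<in> nbr2 G D x} = nbr2 G D y" using nbr2_sym nbr2_sub y by blast
    then show "(\<Sum>x\<in>{x \<in> D. y \<in> nbr2 G D x}. v y) = of_nat m * v y" using m[OF y] by simp
  qed
  finally have "(of_nat (card D) - of_nat m) * sum v D = 0"
    by (simp add: sum_distrib_left algebra_simps)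
  moreover have "m < card D"
    unfolding m_def using finite_D nbr2_sub nbr2_irrefl d by (intro psubset_card_mono) auto
  then have "(of_nat (card D) :: 'f) - of_nat m \<noteq> 0" by simp
  ultimately have total: "sum v D = 0" by simp
  show ?thesis
  proof (cases "nbr2 G D d = {}")
    \<comment> \<open>Without commuting pairs all of \<open>D\<close> is one class, so
      \<open>v\<close> is constant with total 0.\<close>
    case True
    then have "nbr2 G D x = {}" if "x \<in> D" for x
      using that m[OF that] commuting.finite_N[OF that] by (simp add: m_def)
    then have "v x = v d" if "x \<in> D" for x
      using that d by (intro v_theta) (simp add: theta_rel_def)
    then have "of_nat (card D) * v d = 0" using total by simp
    then show ?thesis using d finite_D by auto
  next
    case False
    \<comment> \<open>\<open>C\<close> is the centralizer of \<open>d\<close>. The plain sum serves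
      as the average, since the factor \<open>card C\<close> is nonzero in characteristic 0.\<close>
    define C where "C = {g \<in> carrier G. conjugate g d = d}"
    define \<phi> where "\<phi> x = (\<Sum>g\<in>C. v (conjugate g x))" for x
    have C_carrier: "C \<subseteq> carrier G" and fin_C: "finite C" using fin by (auto simp: C_def)
    have \<phi>_conj: "\<phi> (conjugate h x) = \<phi> x" if h: "h \<in> C" and x: "x \<in> D" for h x
    proof -
      have hG: "h \<in> carrier G" and hd: "conjugate h d = d" using h by (auto simp: C_def)
      have hd': "conjugate (inv h) d = d" using conjugate_inv[of h d] hG hd d by simp
      have "(\<Sum>g\<in>C. v (conjugate g (conjugate h x))) = (\<Sum>g\<in>C. v (conjugate (g \<otimes> h) x))"
        using C_carrier hG x by (intro sum.cong) (auto simp: conjugate_mult)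
      also have "\<dots> = (\<Sum>g\<in>C. v (conjugate g x))"
        by (rule sum.reindex_bij_witness[where i = "\<lambda>g. g \<otimes> inv h" and j = "\<lambda>g. g \<otimes> h"])
          (use hG hd hd' d in \<open>auto simp: C_def m_assoc conjugate_mult\<close>)
      finally show ?thesis by (simp add: \<phi>_def)
    qed
    have "\<phi> d = 0"
    proof (rule commuting.harmonic_zero[OF d False])
      fix x assume x: "x \<in> D"
      have "(\<Sum>y\<in>nbr2 G D x. \<phi> y) = (\<Sum>g\<in>C. \<Sum>y\<in>nbr2 G D x. v (conjugate g y))"
        unfolding \<phi>_def by (rule sum.swap)
      also have "\<dots> = (\<Sum>g\<in>C. \<Sum>y\<in>nbr2 G D (conjugate g x). v y)"
      proof (rule sum.cong[OF refl])
        fix g assume "g \<in> C"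
        then have g: "g \<in> carrier G" using C_carrier by blast
        have "inj_on (conjugate g) (nbr2 G D x)"
          using bij_conjugate[OF g] nbr2_sub by (meson bij_betw_imp_inj_on inj_on_subset)
        then show "(\<Sum>y\<in>nbr2 G D x. v (conjugate g y)) = (\<Sum>y\<in>nbr2 G D (conjugate g x). v y)"
          unfolding conjugate_nbr2[OF g x] by (simp add: sum.reindex)
      qed
      also have "\<dots> = 0" using sum_N total conjugate_D x C_carrier by (intro sum.neutral) auto
      finally show "(\<Sum>y\<in>nbr2 G D x. \<phi> y) = 0" .
    next
      fix e f assume e: "e \<in> nbr2 G D d" and f: "f \<in> nbr2 G D d" and ef: "f \<notin> nbr2 G D e"
      have eD: "e \<in> D" and fD: "f \<in> D" using e f nbr2_sub by auto
      show "\<phi> e = \<phi> f"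
      proof (cases "e = f")
        case False
        then have f3: "f \<in> nbr3 G D e" using ef fD eD by (simp add: nbr3_eq)
        \<comment> \<open>Both factors centralize \<open>d\<close>, and for collinear
          \<open>e\<close>, \<open>f\<close> the product moves \<open>e\<close> to
          \<open>f\<close>.\<close>
        have "e \<otimes> f \<in> C"
          using nbr2_conjugate[OF d] e f eD fD d by (simp add: C_def conjugate_mult)
        then show ?thesis using \<phi>_conj[OF _ eD] conjugate_prod_nbr3[OF eD f3] by metis
      qed simp
    next
      fix w y
      assume w: "w \<in> D - nbr2 G D d - {d}" and y: "y \<in> D - nbr2 G D d - {d}" and yw: "y \<in> nbr2 G D w"
      have wD: "w \<in> D" using w by blast
      have wy: "w \<otimes> y = y \<otimes> w" using yw wD by (simp add: nbr2_iff)
      have "w \<in> nbr3 G D d" "y \<in> nbr3 G D d" using w y nbr3_eq[OF d] by auto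
      note A3 = A3_relations[OF d this wy]
      \<comment> \<open>The element of the \<open>A\<^sub>3\<close> relations that moves
        \<open>w\<close> to \<open>y\<close> is a product of \<open>d\<close> and a point commuting
        with \<open>d\<close>, so it lies in \<open>C\<close>.\<close>
      have "conjugate (conjugate (w \<otimes> y) d) d = d"
        using A3(1,2) d by (simp add: conjugate_fixed_iff)
      then have "d \<otimes> conjugate (w \<otimes> y) d \<in> C"
        using A3(1) d by (simp add: C_def conjugate_mult conjugate_commuting)
      then show "\<phi> y = \<phi> w" using \<phi>_conj[OF _ wD] A3(3) by metis
    next
      fix x assume x: "x \<in> D" "nbr2 G D x = nbr2 G D d"
      then have "theta_rel G D x d" using d by (simp add: theta_rel_def)
      then show "\<phi> x = \<phi> d"
        unfolding \<phi>_def using theta_conjugate C_carrier v_theta by (intro sum.cong) auto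
    qed
    moreover have "\<phi> d = of_nat (card C) * v d" by (simp add: \<phi>_def C_def)
    moreover have "\<one> \<in> C" using d by (simp add: C_def conjugate_one)
    then have "card C \<noteq> 0" using fin_C by auto
    ultimately show ?thesis by simp
  qed
qed

end

section \<open>Eigenspaces of the collinearity map\<close>

lemma lookup_basis_vec: "Poly_Mapping.lookup (basis_vec d) x = (if x = d then 1 else 0)"
  by (auto simp: basis_vec_def lookup_single when_def)

lemma lookup_sum_basis_vec:
  "finite S \<Longrightarrow> Poly_Mapping.lookup (\<Sum>d\<in>S. vscale (f d) (basis_vec d)) x = (if x \<in> S then f x else 0)"
  by (simp add: lookup_sum lookup_basis_vec if_distrib cong: if_cong)

lemma subspace_matsuo_space: "vs.subspace (matsuo_space D)"
  by (simp add: matsuo_space_def)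

lemma matsuo_space_iff:
  assumes "finite D"
  shows "v \<in> matsuo_space D \<longleftrightarrow> (\<forall>x. x \<notin> D \<longrightarrow> Poly_Mapping.lookup v x = 0)"
proof
  assume "v \<in> matsuo_space D"
  moreover have "matsuo_space D \<subseteq> {v. \<forall>x. x \<notin> D \<longrightarrow> Poly_Mapping.lookup v x = 0}"
    unfolding matsuo_space_def
    by (rule vs.span_minimal) (auto simp: lookup_basis_vec vs.subspace_def lookup_add)
  ultimately show "\<forall>x. x \<notin> D \<longrightarrow> Poly_Mapping.lookup v x = 0" by blast
next
  assume "\<forall>x. x \<notin> D \<longrightarrow> Poly_Mapping.lookup v x = 0"
  then have "v = (\<Sum>d\<in>D. vscale (Poly_Mapping.lookup v d) (basis_vec d))"
    using assms by (intro poly_mapping_eqI) (simp add: lookup_sum_basis_vec)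
  also have "\<dots> \<in> matsuo_space D"
    unfolding matsuo_space_def by (intro vs.span_sum vs.span_scale vs.span_base) auto
  finally show "v \<in> matsuo_space D" .
qed

lemma basis_vec_eq_iff: "basis_vec c = (basis_vec d :: 'g \<Rightarrow>\<^sub>0 'f::field) \<longleftrightarrow> c = d"
  by (metis lookup_basis_vec zero_neq_one)

lemma dim_matsuo_space: "vdim (matsuo_space D :: ('g \<Rightarrow>\<^sub>0 'f::field) set) = card D"
proof -
  have "vdim (matsuo_space D :: ('g \<Rightarrow>\<^sub>0 'f) set) = card (basis_vec ` D :: ('g \<Rightarrow>\<^sub>0 'f) set)"
    unfolding matsuo_space_def by (rule vs.dim_span_eq_card_independent[OF independent_basis_vec])
  also have "\<dots> = card D" by (rule card_image) (simp add: inj_on_def basis_vec_eq_iff)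
  finally show ?thesis .
qed

lemma dim_image_inj:
  fixes L :: "('g \<Rightarrow>\<^sub>0 'f::field) \<Rightarrow> ('h \<Rightarrow>\<^sub>0 'f)"
  assumes lin: "Vector_Spaces.linear vscale vscale L" and S: "vs.subspace S" and inj: "inj_on L S"
  shows "vdim (L ` S) = vdim S"
proof -
  interpret L: Vector_Spaces.linear "vscale :: 'f \<Rightarrow> ('g \<Rightarrow>\<^sub>0 'f) \<Rightarrow> _" "vscale :: 'f \<Rightarrow> ('h \<Rightarrow>\<^sub>0 'f) \<Rightarrow> _" L
    by (rule lin)
  obtain B where B: "B \<subseteq> S" "vs.independent B" "S \<subseteq> vspan B" "card B = vdim S"
    using vs.basis_exists by blast
  have span_B: "vspan B = S" using B S vs.span_subspace by blast
  have "vs.independent (L ` B)"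
    using L.independent_injective_image[OF B(2), folded vspan_def] inj span_B by simp
  then have "vdim (L ` S) = card (L ` B)"
    using vs.dim_span_eq_card_independent[of "L ` B"] L.span_image[of B, folded vspan_def] span_B by simp
  also have "\<dots> = vdim S" using B(1,4) inj by (metis card_image inj_on_subset)
  finally show ?thesis .
qed

text \<open>The map is defined by columns; symmetry of collinearity lets a coordinate be read off
  along a row. Symmetry is an assumption so that the formula serves both \<open>D\<close> and its
  image in the quotient.\<close>

lemma lookup_collinearity_map:
  assumes "finite D" and sym: "\<And>c d. \<lbrakk>d \<in> D; c \<in> nbr3 G D d\<rbrakk> \<Longrightarrow> d \<in> nbr3 G D c"
  shows "Poly_Mapping.lookup (collinearity_map G D v) x =
    (if x \<in> D then \<Sum>d\<in>nbr3 G D x. Poly_Mapping.lookup v d else 0)"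
proof -
  have sub: "nbr3 G D d \<subseteq> D" for d by (auto simp: nbr3_def)
  then have fin: "finite (nbr3 G D d)" for d using assms(1) finite_subset by blast
  have "Poly_Mapping.lookup (collinearity_map G D v) x =
      (\<Sum>d\<in>D. if x \<in> nbr3 G D d then Poly_Mapping.lookup v d else 0)"
    unfolding collinearity_map_def lookup_sum lookup_vscale
    by (intro sum.cong) (simp_all add: lookup_basis_vec fin)
  also have "\<dots> = (\<Sum>d\<in>{d \<in> D. x \<in> nbr3 G D d}. Poly_Mapping.lookup v d)"
    by (rule sum.inter_filter[OF assms(1), symmetric])
  also have "{d \<in> D. x \<in> nbr3 G D d} = (if x \<in> D then nbr3 G D x else {})"
    using sym sub by auto
  finally show ?thesis by simp
qed

lemma subspace_eigenspace_on:
  assumes "Vector_Spaces.linear vscale vscale T" "vs.subspace M"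
  shows "vs.subspace (eigenspace_on T M r)"
proof -
  interpret T: Vector_Spaces.linear vscale vscale T by (rule assms(1))
  show ?thesis using assms(2)
    by (auto simp: vs.subspace_def eigenspace_on_def T.add T.scale vs.scale_right_distrib
      vs.scale_left_commute)
qed

section \<open>The projection onto the quotient and its fibres\<close>

context connected_three_transposition_group
begin

definition proj :: "'a \<Rightarrow> 'a set"
  where "proj d = theta_subgroup G D #> d"

lemma hat_set_eq: "hat_set G D = proj ` D"
  by (simp add: hat_set_def proj_def[abs_def])

lemma prod_mem_iff: "\<lbrakk>d \<in> D; e \<in> D\<rbrakk> \<Longrightarrow> d \<otimes> e \<in> theta_subgroup G D \<longleftrightarrow> theta_rel G D d e"
  using theta_of_prod_mem theta_prod_mem by blast

lemma theta_subgroup_subgroup: "subgroup (theta_subgroup G D) G"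
  using theta_subgroup_normal by (rule normal_imp_subgroup)

lemma theta_subgroup_sub: "theta_subgroup G D \<subseteq> carrier G"
  using theta_subgroup_subgroup by (rule subgroup.subset)

lemma mem_coset_iff:
  assumes "d \<in> D" "x \<in> D"
  shows "x \<in> d <# theta_subgroup G D \<longleftrightarrow> theta_rel G D d x"
proof -
  have "x \<in> d <# theta_subgroup G D \<longleftrightarrow> d \<otimes> x \<in> theta_subgroup G D"
  proof
    assume "x \<in> d <# theta_subgroup G D"
    then obtain n where "n \<in> theta_subgroup G D" "x = d \<otimes> n" by (auto simp: l_coset_def)
    then show "d \<otimes> x \<in> theta_subgroup G D"
      using assms theta_subgroup_sub by (auto simp: D_square_left)
  next
    assume "d \<otimes> x \<in> theta_subgroup G D"
    moreover have "x = d \<otimes> (d \<otimes> x)" using assms by (simp add: D_square_left)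
    ultimately show "x \<in> d <# theta_subgroup G D" unfolding l_coset_def by blast
  qed
  with prod_mem_iff[OF assms] show ?thesis by simp
qed

lemma proj_eq_iff:
  assumes d: "d \<in> D" and e: "e \<in> D" shows "proj d = proj e \<longleftrightarrow> theta_rel G D d e"
proof
  assume "proj d = proj e"
  then have "d \<in> theta_subgroup G D #> e"
    using rcos_self[OF _ theta_subgroup_subgroup, of d] d by (simp add: proj_def)
  then obtain n where "n \<in> theta_subgroup G D" "d = n \<otimes> e" by (auto simp: r_coset_def)
  then have "d \<otimes> e \<in> theta_subgroup G D"
    using e theta_subgroup_sub by (auto simp: m_assoc D_square)
  then show "theta_rel G D d e" using prod_mem_iff[OF d e] by simp
next
  assume "theta_rel G D d e"
  then have "d \<otimes> e \<in> theta_subgroup G D" by (rule theta_prod_mem)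
  moreover have "d = (d \<otimes> e) \<otimes> e" using d e by (simp add: m_assoc D_square)
  ultimately have "d \<in> theta_subgroup G D #> e" unfolding r_coset_def by blast
  then show "proj d = proj e"
    using repr_independence[OF _ _ theta_subgroup_subgroup] e by (simp add: proj_def)
qed

text \<open>The order of the image divides \<open>k\<close> exactly when the \<open>k\<close>-th
  power of \<open>d \<otimes> e\<close> lies in \<theta>(G). So collinearity is lost only if
  \<open>d \<otimes> e\<close> becomes trivial, and it never arises from a commuting pair.\<close>

lemma hat_nbr3_iff:
  assumes d: "d \<in> D" and e: "e \<in> D"
  shows "proj e \<in> nbr3 (hat_group G D) (hat_set G D) (proj d) \<longleftrightarrow>
    e \<in> nbr3 G D d \<and> \<not> theta_rel G D d e"
proof -
  interpret N: normal "theta_subgroup G D" G by (rule theta_subgroup_normal)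
  interpret H: group "hat_group G D" unfolding hat_group_def by (rule N.factorgroup_is_group)
  let ?N = "theta_subgroup G D" and ?x = "theta_subgroup G D #> (d \<otimes> e)"
  have prod: "proj d \<otimes>\<^bsub>hat_group G D\<^esub> proj e = ?x"
    using d e by (simp add: proj_def hat_group_def N.rcos_sum)
  have x: "?x \<in> carrier (hat_group G D)"
    using d e by (auto simp: hat_group_def carrier_FactGroup)
  have ord_dvd: "H.ord ?x dvd k \<longleftrightarrow> (d \<otimes> e) [^] k \<in> ?N" for k
  proof -
    have "?N #> y = ?N \<longleftrightarrow> y \<in> ?N" if "y \<in> carrier G" for y
      using that coset_join1[OF _ that] coset_join2[OF that] theta_subgroup_subgroup
        theta_subgroup_sub by blast
    then show ?thesis
      using H.pow_eq_id[OF x, of k] N.FactGroup_pow[of "d \<otimes> e" k] d e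
      by (simp add: hat_group_def)
  qed
  have "H.ord ?x = 3 \<longleftrightarrow> ord (d \<otimes> e) = 3 \<and> d \<otimes> e \<notin> ?N"
  proof
    assume H: "H.ord ?x = 3"
    have "\<not> H.ord ?x dvd 1" "\<not> H.ord ?x dvd 2" unfolding H by auto
    then have notin: "d \<otimes> e \<notin> ?N" "(d \<otimes> e) [^] (2::nat) \<noteq> \<one>"
      unfolding ord_dvd using d e N.one_closed by auto
    have "(d \<otimes> e) [^] ord (d \<otimes> e) = \<one>" using d e by simp
    with notin have "ord (d \<otimes> e) \<noteq> 1" "ord (d \<otimes> e) \<noteq> 2"
      using ord_eq_1[of "d \<otimes> e"] N.one_closed d e by (auto simp del: pow_ord_eq_1)
    then show "ord (d \<otimes> e) = 3 \<and> d \<otimes> e \<notin> ?N"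
      using ord_prod_cases[OF d e] notin(1) by auto
  next
    assume G: "ord (d \<otimes> e) = 3 \<and> d \<otimes> e \<notin> ?N"
    then have "(d \<otimes> e) [^] (3::nat) \<in> ?N" "(d \<otimes> e) [^] (1::nat) \<notin> ?N"
      using pow_ord_eq_1[of "d \<otimes> e"] N.one_closed d e by auto
    then have "H.ord ?x dvd 3" "H.ord ?x \<noteq> 1" using ord_dvd[of 3] ord_dvd[of 1] by auto
    moreover from this have "H.ord ?x \<le> 3" by (intro dvd_imp_le) auto
    then have "H.ord ?x \<in> {0, 1, 2, 3}" by auto
    ultimately show "H.ord ?x = 3" by auto
  qed
  then show ?thesis
    using d e prod_mem_iff[OF d e] prod by (auto simp: nbr3_def hat_set_eq)
qed

lemma finite_hat_set: "finite (hat_set G D)"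
  using finite_D by (simp add: hat_set_eq)

lemma hat_nbr3_sym:
  assumes "b \<in> hat_set G D" "c \<in> nbr3 (hat_group G D) (hat_set G D) b"
  shows "b \<in> nbr3 (hat_group G D) (hat_set G D) c"
proof -
  have "c \<in> hat_set G D" using assms by (simp add: nbr3_def)
  with assms obtain d e where "b = proj d" "c = proj e" "d \<in> D" "e \<in> D" by (auto simp: hat_set_eq)
  with assms show ?thesis using hat_nbr3_iff nbr3_sym theta_sym by metis
qed

lemmas lookup_collinearity = lookup_collinearity_map[OF finite_D nbr3_sym]
lemmas lookup_hat_collinearity = lookup_collinearity_map[OF finite_hat_set hat_nbr3_sym]

section \<open>Pullback of vectors along the projection\<close>

definition lift :: "('a set \<Rightarrow>\<^sub>0 'f::field) \<Rightarrow> ('a \<Rightarrow>\<^sub>0 'f)"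
  where "lift w = (\<Sum>d\<in>D. vscale (Poly_Mapping.lookup w (proj d)) (basis_vec d))"

lemma lookup_lift:
  "Poly_Mapping.lookup (lift w) x = (if x \<in> D then Poly_Mapping.lookup w (proj x) else 0)"
  unfolding lift_def by (rule lookup_sum_basis_vec[OF finite_D])

lemma linear_lift: "Vector_Spaces.linear vscale vscale lift"
  by unfold_locales
    (auto intro!: poly_mapping_eqI simp: lookup_lift lookup_add algebra_simps)

lemma lift_eq_iff:
  assumes "v \<in> matsuo_space (hat_set G D)" "w \<in> matsuo_space (hat_set G D)"
  shows "lift v = lift w \<longleftrightarrow> v = w"
proof
  assume eq: "lift v = lift w"
  show "v = w"
  proof (rule poly_mapping_eqI)
    fix c show "Poly_Mapping.lookup v c = Poly_Mapping.lookup w c"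
    proof (cases "c \<in> hat_set G D")
      case True
      then obtain d where "c = proj d" "d \<in> D" by (auto simp: hat_set_eq)
      then show ?thesis using arg_cong[OF eq, of "\<lambda>u. Poly_Mapping.lookup u d"]
        by (simp add: lookup_lift)
    qed (use assms in \<open>simp add: matsuo_space_iff finite_hat_set\<close>)
  qed
qed simp

lemma lift_in_matsuo_space: "lift w \<in> matsuo_space D"
  by (simp add: matsuo_space_iff finite_D lookup_lift)

text \<open>A class-constant vector descends: its value on a class is read off at a chosen
  point.\<close>

lemma lift_surj:
  assumes v: "v \<in> matsuo_space D"
    and const: "\<And>x y. theta_rel G D x y \<Longrightarrow> Poly_Mapping.lookup v x = Poly_Mapping.lookup v y"
  shows "\<exists>w\<in>matsuo_space (hat_set G D). lift w = v"
proof -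
  define w where
    "w = (\<Sum>c\<in>hat_set G D. vscale (Poly_Mapping.lookup v (inv_into D proj c)) (basis_vec c))"
  have w: "Poly_Mapping.lookup w c =
      (if c \<in> hat_set G D then Poly_Mapping.lookup v (inv_into D proj c) else 0)" for c
    unfolding w_def by (rule lookup_sum_basis_vec[OF finite_hat_set])
  have "lift w = v"
  proof (rule poly_mapping_eqI)
    fix x show "Poly_Mapping.lookup (lift w) x = Poly_Mapping.lookup v x"
    proof (cases "x \<in> D")
      case True
      have "inv_into D proj (proj x) \<in> D" "proj (inv_into D proj (proj x)) = proj x"
        using True inv_into_into[of "proj x" proj D] f_inv_into_f[of "proj x" proj D] by simp_all
      then have "theta_rel G D (inv_into D proj (proj x)) x" using proj_eq_iff True by blast
      then show ?thesis using True const by (simp add: lookup_lift w hat_set_eq)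
    qed (use v in \<open>simp add: lookup_lift matsuo_space_iff finite_D\<close>)
  qed
  moreover have "w \<in> matsuo_space (hat_set G D)"
    by (simp add: matsuo_space_iff finite_hat_set w)
  ultimately show ?thesis by blast
qed

lemma sum_nbr3_insert:
  assumes x: "x \<in> D"
  shows "f x + (\<Sum>y\<in>nbr3 G D x. f y) = (\<Sum>y\<in>D - nbr2 G D x. (f y :: 'f::field))"
proof -
  have "finite (D - nbr2 G D x)" "x \<in> D - nbr2 G D x"
    using finite_D x nbr2_irrefl by auto
  then show ?thesis using nbr3_eq[OF x] sum.remove[of "D - nbr2 G D x" x f] by simp
qed

lemma eigenspace_lookup:
  assumes "v \<in> eigenspace_on (collinearity_map G D) (matsuo_space D) r" "x \<in> D"
  shows "(\<Sum>y\<in>D - nbr2 G D x. Poly_Mapping.lookup v y) = (r + 1) * Poly_Mapping.lookup v x"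
proof -
  have "collinearity_map G D v = vscale r v" using assms(1) by (simp add: eigenspace_on_def)
  from arg_cong[OF this, of "\<lambda>u. Poly_Mapping.lookup u x"] show ?thesis
    using assms(2) sum_nbr3_insert[OF assms(2), of "Poly_Mapping.lookup v"]
    by (simp add: lookup_collinearity algebra_simps)
qed

section \<open>The subspace \<open>U\<close> inside the eigenspace of -1\<close>

lemma theta_space_sub_eigenspace:
  "theta_space G D \<subseteq> eigenspace_on (collinearity_map G D) (matsuo_space D) (-1 :: 'f::field)"
  unfolding theta_space_def
proof (rule vs.span_minimal)
  show "vs.subspace (eigenspace_on (collinearity_map G D) (matsuo_space D) (-1 :: 'f))"
    by (intro subspace_eigenspace_on collinearity_map_linear subspace_matsuo_space)
  show "{basis_vec c - basis_vec d |c d. theta_rel G D c d} \<subseteq>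
    eigenspace_on (collinearity_map G D) (matsuo_space D) (-1 :: 'f)"
  proof
    fix u :: "'a \<Rightarrow>\<^sub>0 'f" assume "u \<in> {basis_vec c - basis_vec d |c d. theta_rel G D c d}"
    then obtain c d where u: "u = basis_vec c - basis_vec d" and cd: "theta_rel G D c d" by blast
    have cD: "c \<in> D" and dD: "d \<in> D" using theta_D[OF cd] by auto
    have "u \<in> matsuo_space D"
      using cD dD unfolding u by (auto simp: matsuo_space_iff finite_D lookup_minus lookup_basis_vec)
    moreover have "collinearity_map G D u = vscale (-1) u"
    proof (rule poly_mapping_eqI)
      fix x
      show "Poly_Mapping.lookup (collinearity_map G D u) x = Poly_Mapping.lookup (vscale (-1) u) x"
      proof (cases "x \<in> D")
        case True
        have fin': "finite (D - nbr2 G D x)" using finite_D by blast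
        \<comment> \<open>Hence \<open>D - D\<^sub>x\<close> contains both \<open>c\<close> and
          \<open>d\<close> or neither, and the coordinates of \<open>u\<close> cancel over
          it.\<close>
        have "c \<in> nbr2 G D x \<longleftrightarrow> d \<in> nbr2 G D x"
          using theta_nbr2[OF cd] nbr2_sym True cD dD by blast
        then have "(\<Sum>y\<in>D - nbr2 G D x. Poly_Mapping.lookup u y) = 0"
          using fin' cD dD by (simp add: u lookup_minus lookup_basis_vec sum_subtractf)
        then show ?thesis
          using True sum_nbr3_insert[OF True, of "Poly_Mapping.lookup u"]
          by (simp add: lookup_collinearity eq_neg_iff_add_eq_0 add.commute)
      qed (use cD dD in \<open>auto simp: lookup_collinearity u lookup_minus lookup_basis_vec\<close>)
    qed
    ultimately show "u \<in> eigenspace_on (collinearity_map G D) (matsuo_space D) (-1)"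
      by (simp add: eigenspace_on_def)
  qed
qed

text \<open>A section \<open>rep\<close> of the projection turns \<open>U\<close> into the image of an injective linear map
  defined on the coordinate subspace of the points that are not representatives.\<close>

definition rep :: "'a \<Rightarrow> 'a"
  where "rep x = inv_into D proj (proj x)"

lemma rep: assumes "x \<in> D" shows "rep x \<in> D" "theta_rel G D x (rep x)"
proof -
  have "rep x \<in> D" "proj (rep x) = proj x"
    using assms inv_into_into[of "proj x" proj D] f_inv_into_f[of "proj x" proj D]
    by (simp_all add: rep_def)
  then show "rep x \<in> D" "theta_rel G D x (rep x)" using proj_eq_iff assms by metis+
qed

lemma rep_eq_iff: "\<lbrakk>x \<in> D; y \<in> D\<rbrakk> \<Longrightarrow> rep x = rep y \<longleftrightarrow> theta_rel G D x y"
  using proj_eq_iff rep theta_sym theta_trans by (metis rep_def)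

lemma rep_rep: "x \<in> D \<Longrightarrow> rep (rep x) = rep x"
  using rep rep_eq_iff theta_sym by blast

lemma rep_image_sub: "rep ` D \<subseteq> D"
  using rep by blast

lemma card_rep_image: "card (rep ` D) = card (hat_set G D)"
proof -
  have "rep ` D = inv_into D proj ` hat_set G D" by (simp add: rep_def hat_set_eq image_image)
  then show ?thesis by (simp add: card_image inj_on_inv_into hat_set_eq)
qed

definition diff_map :: "('a \<Rightarrow>\<^sub>0 'f::field) \<Rightarrow> ('a \<Rightarrow>\<^sub>0 'f)"
  where "diff_map v = (\<Sum>d\<in>D. vscale (Poly_Mapping.lookup v d) (basis_vec d - basis_vec (rep d)))"

lemma linear_diff_map: "Vector_Spaces.linear vscale vscale diff_map"
  by unfold_locales
    (auto simp: diff_map_def lookup_add vs.scale_left_distrib sum.distrib vs.scale_sum_right)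

lemma lookup_diff_map:
  assumes "x \<in> D"
  shows "Poly_Mapping.lookup (diff_map v) x =
    Poly_Mapping.lookup v x - (\<Sum>d\<in>{d \<in> D. rep d = x}. Poly_Mapping.lookup v d)"
proof -
  have "Poly_Mapping.lookup (diff_map v) x =
      (\<Sum>d\<in>D. (if d = x then Poly_Mapping.lookup v d else 0)) -
      (\<Sum>d\<in>D. (if rep d = x then Poly_Mapping.lookup v d else 0))"
    unfolding diff_map_def lookup_sum sum_subtractf[symmetric]
    by (intro sum.cong) (auto simp: lookup_minus lookup_basis_vec)
  then show ?thesis using assms finite_D by (simp add: sum.inter_filter)
qed

lemma lookup_diff_map_nonrep:
  assumes "x \<in> D - rep ` D"
  shows "Poly_Mapping.lookup (diff_map v) x = Poly_Mapping.lookup v x"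
proof -
  have "{d \<in> D. rep d = x} = {}" using assms by blast
  then show ?thesis using lookup_diff_map[of x v] assms by (simp only: sum.empty diff_zero DiffD1)
qed

text \<open>\<open>diff_map\<close> keeps the coordinates at non-representatives, and vectors of
  this space have no others.\<close>

lemma inj_diff_map: "inj_on diff_map (matsuo_space (D - rep ` D) :: ('a \<Rightarrow>\<^sub>0 'f::field) set)"
proof (rule inj_onI)
  fix v w :: "'a \<Rightarrow>\<^sub>0 'f" assume vw: "v \<in> matsuo_space (D - rep ` D)" "w \<in> matsuo_space (D - rep ` D)"
    and eq: "diff_map v = diff_map w"
  show "v = w"
  proof (rule poly_mapping_eqI)
    fix x show "Poly_Mapping.lookup v x = Poly_Mapping.lookup w x"
    proof (cases "x \<in> D - rep ` D")
      case True
      then show ?thesis using eq lookup_diff_map_nonrep by metis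
    next
      case False
      then show ?thesis using vw matsuo_space_iff[of "D - rep ` D"] finite_D by (metis finite_Diff)
    qed
  qed
qed

lemma diff_map_in_theta_space: "diff_map v \<in> theta_space G D"
  unfolding diff_map_def theta_space_def
  using rep by (intro vs.span_sum vs.span_scale vs.span_base) blast

text \<open>Deleting the coordinates of \<open>v\<close> at representatives gives a preimage:
  vanishing class sums force the deleted coordinate to be minus the sum of the others in its
  class.\<close>

lemma diff_map_surj:
  assumes v: "v \<in> matsuo_space D"
    and zero: "\<And>x. x \<in> D \<Longrightarrow> (\<Sum>y\<in>{y \<in> D. theta_rel G D x y}. Poly_Mapping.lookup v y) = 0"
  shows "v \<in> diff_map ` matsuo_space (D - rep ` D)"
proof -
  define w where
    "w = (\<Sum>d\<in>D - rep ` D. vscale (Poly_Mapping.lookup v d) (basis_vec d))"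
  have fin': "finite (D - rep ` D)" using finite_D by blast
  have w: "Poly_Mapping.lookup w x = (if x \<in> D - rep ` D then Poly_Mapping.lookup v x else 0)" for x
    unfolding w_def by (rule lookup_sum_basis_vec[OF fin'])
  have "diff_map w = v"
  proof (rule poly_mapping_eqI)
    fix x
    consider "x \<notin> D" | "x \<in> D - rep ` D" | "x \<in> rep ` D" by blast
    then show "Poly_Mapping.lookup (diff_map w) x = Poly_Mapping.lookup v x"
    proof cases
      case 1
      then show ?thesis
        using v diff_map_in_theta_space[of w] theta_space_sub_eigenspace
        by (auto simp: eigenspace_on_def matsuo_space_iff finite_D)
    next
      case 2
      then show ?thesis using w[of x] lookup_diff_map_nonrep[of x w] by simp
    next
      case 3
      then have xD: "x \<in> D" and rx: "rep x = x" using rep rep_rep by auto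
      have cls: "{d \<in> D. rep d = x} = {y \<in> D. theta_rel G D x y}"
        using rep_eq_iff[OF xD] rx by metis
      have "(\<Sum>d\<in>{d \<in> D. rep d = x}. Poly_Mapping.lookup w d) =
          (\<Sum>d\<in>{d \<in> D. rep d = x} - {x}. Poly_Mapping.lookup v d)"
      proof (rule sum.mono_neutral_cong_right)
        show "\<And>d. d \<in> {d \<in> D. rep d = x} - {x} \<Longrightarrow> Poly_Mapping.lookup w d = Poly_Mapping.lookup v d"
          using rep_rep by (auto simp: w)
      qed (use finite_D 3 w in auto)
      also have "\<dots> = - Poly_Mapping.lookup v x"
        using sum.remove[of "{d \<in> D. rep d = x}" x "Poly_Mapping.lookup v"] finite_D xD rx
          zero[OF xD] cls theta_refl[OF xD] by (simp add: eq_neg_iff_add_eq_0 add.commute)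
      finally show ?thesis using xD 3 by (simp add: lookup_diff_map w)
    qed
  qed
  moreover have "w \<in> matsuo_space (D - rep ` D)" by (simp add: matsuo_space_iff fin' w)
  ultimately show ?thesis by blast
qed

section \<open>Classes of size 3^h and the action of \<open>t\<close> on pulled back vectors\<close>

lemma card_theta_class:
  assumes "three_bullet G D h" "x \<in> D"
  shows "card {y \<in> D. theta_rel G D x y} = 3 ^ h"
proof -
  have "{y \<in> D. theta_rel G D x y} = D \<inter> (x <# theta_subgroup G D)"
    using mem_coset_iff[OF assms(2)] by blast
  then show ?thesis using assms by (simp add: three_bullet_def)
qed

lemma sum_over_classes:
  fixes f :: "'a set \<Rightarrow> 'f::field"
  assumes h: "three_bullet G D h" and S: "S \<subseteq> hat_set G D"
  shows "(\<Sum>y\<in>{y \<in> D. proj y \<in> S}. f (proj y)) = 3 ^ h * (\<Sum>c\<in>S. f c)"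
proof -
  let ?P = "{y \<in> D. proj y \<in> S}"
  have fin': "finite ?P" using finite_D by simp
  have im: "proj ` ?P = S" using S by (auto simp: hat_set_eq)
  have "(\<Sum>y\<in>?P. f (proj y)) = (\<Sum>c\<in>S. \<Sum>y\<in>{y \<in> ?P. proj y = c}. f (proj y))"
    using sum.image_gen[OF fin', of "\<lambda>y. f (proj y)" proj] im by simp
  also have "\<dots> = (\<Sum>c\<in>S. 3 ^ h * f c)"
  proof (rule sum.cong[OF refl])
    fix c assume c: "c \<in> S"
    then obtain x where x: "x \<in> D" "c = proj x" using S by (auto simp: hat_set_eq)
    have "{y \<in> ?P. proj y = c} = {y \<in> D. theta_rel G D x y}"
      using c x proj_eq_iff[OF x(1)] by (auto simp: eq_commute)
    then have "card {y \<in> ?P. proj y = c} = 3 ^ h" using card_theta_class[OF h x(1)] by simp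
    then show "(\<Sum>y\<in>{y \<in> ?P. proj y = c}. f (proj y)) = 3 ^ h * f c" by simp
  qed
  finally show ?thesis by (simp add: sum_distrib_left)
qed

lemma card_D:
  assumes h: "three_bullet G D h" shows "card D = 3 ^ h * card (hat_set G D)"
proof -
  have "{y \<in> D. proj y \<in> hat_set G D} = D" by (auto simp: hat_set_eq)
  \<comment> \<open>The sum formula lives in a field, so the points are counted in the rationals
    first.\<close>
  then have "rat_of_nat (card D) = 3 ^ h * rat_of_nat (card (hat_set G D))"
    using sum_over_classes[OF h order_refl, of "\<lambda>_. 1 :: rat"] by simp
  also have "\<dots> = rat_of_nat (3 ^ h * card (hat_set G D))" by simp
  finally show ?thesis by (simp only: of_nat_eq_iff)
qed

text \<open>The points collinear with \<open>x\<close> are the other 3^h - 1 points of its class,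
  since related points never commute, and the full fibres over the neighbours of
  \<open>proj x\<close>.\<close>

lemma collinearity_lift:
  fixes w :: "'a set \<Rightarrow>\<^sub>0 'f::field"
  assumes h: "three_bullet G D h"
  shows "collinearity_map G D (lift w) =
    lift (vscale (3 ^ h) (collinearity_map (hat_group G D) (hat_set G D) w) + vscale (3 ^ h - 1) w)"
proof (rule poly_mapping_eqI)
  fix x
  let ?hat3 = "nbr3 (hat_group G D) (hat_set G D) (proj x)"
  let ?R = "vscale (3 ^ h) (collinearity_map (hat_group G D) (hat_set G D) w) + vscale (3 ^ h - 1) w"
  show "Poly_Mapping.lookup (collinearity_map G D (lift w)) x = Poly_Mapping.lookup (lift ?R) x"
  proof (cases "x \<in> D")
    case x: True
    let ?f = "\<lambda>y. Poly_Mapping.lookup w (proj y)"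
    let ?C = "{y \<in> D. theta_rel G D x y}" and ?P = "{y \<in> D. proj y \<in> ?hat3}"
    have "nbr3 G D x = (?C - {x}) \<union> ?P"
    proof (intro equalityI subsetI)
      fix y assume "y \<in> nbr3 G D x"
      then show "y \<in> (?C - {x}) \<union> ?P"
        using hat_nbr3_iff[OF x, of y] x nbr3_sub by (auto simp: nbr3_iff)
    next
      fix y assume "y \<in> (?C - {x}) \<union> ?P"
      then show "y \<in> nbr3 G D x"
        using hat_nbr3_iff[OF x, of y] theta_not_nbr2[of x y] by (auto simp: nbr3_eq[OF x])
    qed
    moreover have "(?C - {x}) \<inter> ?P = {}" using hat_nbr3_iff[OF x] by blast
    ultimately have "(\<Sum>y\<in>nbr3 G D x. ?f y) = (\<Sum>y\<in>?C - {x}. ?f y) + (\<Sum>y\<in>?P. ?f y)"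
      using finite_D by (simp add: sum.union_disjoint)
    also have "(\<Sum>y\<in>?P. ?f y) = 3 ^ h * (\<Sum>c\<in>?hat3. Poly_Mapping.lookup w c)"
      by (rule sum_over_classes[OF h]) (auto simp: nbr3_def)
    also have "(\<Sum>y\<in>?C - {x}. ?f y) = (\<Sum>y\<in>?C - {x}. ?f x)"
      using proj_eq_iff[OF x] by (intro sum.cong refl) (metis DiffD1 mem_Collect_eq)
    also have "\<dots> = (3 ^ h - 1) * ?f x"
      using card_theta_class[OF h x] theta_refl[OF x] x finite_D
      by (simp add: card_Diff_singleton of_nat_diff)
    finally have "(\<Sum>y\<in>nbr3 G D x. ?f y) =
      (3 ^ h - 1) * ?f x + 3 ^ h * (\<Sum>c\<in>?hat3. Poly_Mapping.lookup w c)" .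
    moreover have "(\<Sum>y\<in>nbr3 G D x. Poly_Mapping.lookup (lift w) y) = (\<Sum>y\<in>nbr3 G D x. ?f y)"
      using nbr3_sub by (intro sum.cong) (auto simp: lookup_lift)
    moreover have "proj x \<in> hat_set G D" using x by (simp add: hat_set_eq)
    ultimately show ?thesis
      using x by (simp add: lookup_collinearity lookup_hat_collinearity lookup_lift[of ?R] lookup_add)
  qed (simp add: lookup_collinearity lookup_lift)
qed

text \<open>By injectivity of \<open>lift\<close> the equation can be compared in the quotient
  space; there the terms with factor 3^h - 1 cancel, and 3^h is invertible in characteristic
  0.\<close>

lemma lift_eigenspace_iff:
  fixes w :: "'a set \<Rightarrow>\<^sub>0 'f::field_char_0"
  assumes h: "three_bullet G D h" and w: "w \<in> matsuo_space (hat_set G D)"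
  shows "lift w \<in> eigenspace_on (collinearity_map G D) (matsuo_space D) (3 ^ h * r + 3 ^ h - 1) \<longleftrightarrow>
    w \<in> eigenspace_on (collinearity_map (hat_group G D) (hat_set G D)) (matsuo_space (hat_set G D)) r"
proof -
  interpret lift: Vector_Spaces.linear "vscale :: 'f \<Rightarrow> ('a set \<Rightarrow>\<^sub>0 'f) \<Rightarrow> _"
    "vscale :: 'f \<Rightarrow> ('a \<Rightarrow>\<^sub>0 'f) \<Rightarrow> _" lift by (rule linear_lift)
  let ?t = "collinearity_map (hat_group G D) (hat_set G D)"
  let ?lhs = "vscale (3 ^ h) (?t w) + vscale (3 ^ h - 1) w"
  have M: "vs.subspace (matsuo_space (hat_set G D) :: ('a set \<Rightarrow>\<^sub>0 'f) set)"
    by (rule subspace_matsuo_space)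
  have "lift w \<in> eigenspace_on (collinearity_map G D) (matsuo_space D) (3 ^ h * r + 3 ^ h - 1) \<longleftrightarrow>
      lift ?lhs = lift (vscale (3 ^ h * r + 3 ^ h - 1) w)"
    by (simp add: eigenspace_on_def lift_in_matsuo_space collinearity_lift[OF h] lift.scale)
  also have "\<dots> \<longleftrightarrow> ?lhs = vscale (3 ^ h * r + 3 ^ h - 1) w"
    by (rule lift_eq_iff) (intro vs.subspace_add[OF M] vs.subspace_scale[OF M] w collinearity_map_closed)+
  also have "vscale (3 ^ h * r + 3 ^ h - 1) w = vscale (3 ^ h) (vscale r w) + vscale (3 ^ h - 1) w"
    by (rule poly_mapping_eqI) (simp add: lookup_add algebra_simps)
  also have "?lhs = \<dots> \<longleftrightarrow> ?t w = vscale r w"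
    by (simp del: vs.scale_scale)
  finally show ?thesis using w by (simp add: eigenspace_on_def)
qed

text \<open>The sum over \<open>D - D\<^sub>x\<close> equals the eigenvalue plus 1 times the
  coordinate at \<open>x\<close>. As that factor is nonzero, eigenvectors are class-constant and
  hence lifts.\<close>

lemma eigenspace_eq_lift:
  fixes r :: "'f::field_char_0"
  assumes h: "three_bullet G D h" and r: "3 ^ h * r + 3 ^ h - 1 \<noteq> -1"
  shows "eigenspace_on (collinearity_map G D) (matsuo_space D) (3 ^ h * r + 3 ^ h - 1) =
    lift ` eigenspace_on (collinearity_map (hat_group G D) (hat_set G D)) (matsuo_space (hat_set G D)) r"
    (is "?E = lift ` ?H")
proof
  show "?E \<subseteq> lift ` ?H"
  proof
    fix v assume v: "v \<in> ?E"
    have "Poly_Mapping.lookup v x = Poly_Mapping.lookup v y" if xy: "theta_rel G D x y" for x y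
    proof -
      have "x \<in> D" "y \<in> D" "nbr2 G D x = nbr2 G D y" using theta_D[OF xy] theta_nbr2[OF xy] by auto
      then have "(3 ^ h * r + 3 ^ h - 1 + 1) * Poly_Mapping.lookup v x =
          (3 ^ h * r + 3 ^ h - 1 + 1) * Poly_Mapping.lookup v y"
        using eigenspace_lookup[OF v] by metis
      moreover have "3 ^ h * r + 3 ^ h - 1 + 1 \<noteq> 0" using r by (metis add_eq_0_iff2)
      ultimately show ?thesis by simp
    qed
    then obtain w where "w \<in> matsuo_space (hat_set G D)" "lift w = v"
      using lift_surj[of v] v by (auto simp: eigenspace_on_def)
    then show "v \<in> lift ` ?H" using lift_eigenspace_iff[OF h] v by blast
  qed
  show "lift ` ?H \<subseteq> ?E"
  proof
    fix v assume "v \<in> lift ` ?H"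
    then obtain w where w: "w \<in> ?H" "v = lift w" by blast
    then have "w \<in> matsuo_space (hat_set G D)" by (simp add: eigenspace_on_def)
    then show "v \<in> ?E" using lift_eigenspace_iff[OF h] w by blast
  qed
qed

lemma multiplicity_lift:
  fixes r :: "'f::field_char_0"
  assumes "three_bullet G D h" "3 ^ h * r + 3 ^ h - 1 \<noteq> -1"
  shows "multiplicity_on (collinearity_map G D) (matsuo_space D) (3 ^ h * r + 3 ^ h - 1) =
    multiplicity_on (collinearity_map (hat_group G D) (hat_set G D)) (matsuo_space (hat_set G D)) r"
  unfolding multiplicity_on_def eigenspace_eq_lift[OF assms]
proof (rule dim_image_inj[OF linear_lift])
  show "vs.subspace (eigenspace_on (collinearity_map (hat_group G D) (hat_set G D))
      (matsuo_space (hat_set G D)) r)"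
    by (intro subspace_eigenspace_on collinearity_map_linear subspace_matsuo_space)
  show "inj_on lift (eigenspace_on (collinearity_map (hat_group G D) (hat_set G D))
      (matsuo_space (hat_set G D)) r)"
    by (auto simp: inj_on_def eigenspace_on_def lift_eq_iff)
qed

lemma eigenvalue_from_hat:
  fixes \<rho> :: "'f::field_char_0"
  assumes h: "three_bullet G D h"
    and \<rho>: "is_eigenvalue (collinearity_map G D) (matsuo_space D) \<rho>" "\<rho> \<noteq> -1"
  shows "\<exists>r. is_eigenvalue (collinearity_map (hat_group G D) (hat_set G D))
      (matsuo_space (hat_set G D)) r \<and> \<rho> = 3 ^ h * r + 3 ^ h - 1"
proof -
  interpret lift: Vector_Spaces.linear "vscale :: 'f \<Rightarrow> ('a set \<Rightarrow>\<^sub>0 'f) \<Rightarrow> _"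
    "vscale :: 'f \<Rightarrow> ('a \<Rightarrow>\<^sub>0 'f) \<Rightarrow> _" lift by (rule linear_lift)
  \<comment> \<open>The solution of \<rho> = 3^h r + 3^h - 1 for \<open>r\<close>.\<close>
  define r where "r = (\<rho> + 1 - 3 ^ h) / 3 ^ h"
  have r: "\<rho> = 3 ^ h * r + 3 ^ h - 1" by (simp add: r_def)
  obtain v where v: "v \<noteq> 0" "v \<in> eigenspace_on (collinearity_map G D) (matsuo_space D) \<rho>"
    using \<rho>(1) by (auto simp: is_eigenvalue_def eigenspace_on_def)
  then obtain w where w: "v = lift w"
    "w \<in> eigenspace_on (collinearity_map (hat_group G D) (hat_set G D)) (matsuo_space (hat_set G D)) r"
    using eigenspace_eq_lift[OF h, of r] \<rho>(2) r by auto
  then have "w \<noteq> 0" using v(1) lift.zero by blast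
  then show ?thesis using w(2) r by (auto simp: is_eigenvalue_def eigenspace_on_def)
qed

section \<open>The full eigenspace of -1 and its dimension\<close>

lemma eigenspace_minus_one_class_sums:
  fixes v :: "'a \<Rightarrow>\<^sub>0 'f::field_char_0"
  assumes h: "three_bullet G D h"
    and v: "v \<in> eigenspace_on (collinearity_map G D) (matsuo_space D) (-1)" and x: "x \<in> D"
  shows "(\<Sum>y\<in>{y \<in> D. theta_rel G D x y}. Poly_Mapping.lookup v y) = 0"
proof -
  define a where "a x = (\<Sum>y\<in>{y \<in> D. theta_rel G D x y}. Poly_Mapping.lookup v y)" for x
  have "a x = 0"
  \<comment> \<open>The class sums \<open>a\<close> are constant on classes and again satisfy the
    equation for -1, so they vanish.\<close>
  proof (rule eigenvector_minus_one_zero[OF _ _ x])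
    show "a y = a z" if "theta_rel G D y z" for y z
      using that unfolding a_def by (intro sum.cong) (auto simp: theta_rel_def)
    fix z assume z: "z \<in> D"
    let ?S = "D - nbr2 G D z"
    have finS: "finite ?S" using finite_D by blast
    have class_S: "u \<in> ?S \<longleftrightarrow> y \<in> ?S" if "theta_rel G D u y" for u y
      using theta_nbr2[OF that] theta_D[OF that] nbr2_sym z by blast
    \<comment> \<open>\<open>?S\<close> is a union of classes, so each coordinate of
      \<open>v\<close> over \<open>?S\<close> is counted once for each of the 3^h points of its
      class.\<close>
    have "(\<Sum>u\<in>?S. a u) = (\<Sum>u\<in>?S. \<Sum>y\<in>{y \<in> ?S. theta_rel G D u y}. Poly_Mapping.lookup v y)"
      unfolding a_def using class_S theta_D by (intro sum.cong) blast+
    also have "\<dots> = (\<Sum>y\<in>?S. \<Sum>u\<in>{u \<in> ?S. theta_rel G D u y}. Poly_Mapping.lookup v y)"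
      by (rule sum.swap_restrict[OF finS finS])
    also have "\<dots> = (\<Sum>y\<in>?S. 3 ^ h * Poly_Mapping.lookup v y)"
    proof (rule sum.cong[OF refl])
      fix y assume y: "y \<in> ?S"
      have "{u \<in> ?S. theta_rel G D u y} = {u \<in> D. theta_rel G D y u}"
        using y class_S theta_sym by blast
      then have "card {u \<in> ?S. theta_rel G D u y} = 3 ^ h" using card_theta_class[OF h, of y] y by simp
      then show "(\<Sum>u\<in>{u \<in> ?S. theta_rel G D u y}. Poly_Mapping.lookup v y) =
        3 ^ h * Poly_Mapping.lookup v y" by simp
    qed
    also have "\<dots> = 0" using eigenspace_lookup[OF v z] by (simp add: sum_distrib_left[symmetric])
    finally show "(\<Sum>u\<in>nbr3 G D z. a u) = - a z"
      using sum_nbr3_insert[OF z, of a] by (simp add: eq_neg_iff_add_eq_0 add.commute)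
  qed
  then show ?thesis by (simp add: a_def)
qed

text \<open>The inclusions close up: vanishing class sums put the eigenspace into the image of
  \<open>diff_map\<close>, which lies in \<open>U\<close>, which lies in the eigenspace.\<close>

lemma eigenspace_minus_one:
  assumes h: "three_bullet G D h"
  shows "eigenspace_on (collinearity_map G D) (matsuo_space D) (-1 :: 'f::field_char_0) = theta_space G D"
    and "theta_space G D = diff_map ` (matsuo_space (D - rep ` D) :: ('a \<Rightarrow>\<^sub>0 'f) set)"
proof -
  let ?E = "eigenspace_on (collinearity_map G D) (matsuo_space D) (-1 :: 'f)"
  let ?I = "diff_map ` (matsuo_space (D - rep ` D) :: ('a \<Rightarrow>\<^sub>0 'f) set)"
  have "?E \<subseteq> ?I"
    using diff_map_surj eigenspace_minus_one_class_sums[OF h] by (auto simp: eigenspace_on_def)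
  moreover have "?I \<subseteq> theta_space G D" using diff_map_in_theta_space by blast
  moreover have "theta_space G D \<subseteq> ?E" by (rule theta_space_sub_eigenspace)
  ultimately show "?E = theta_space G D" "theta_space G D = ?I" by blast+
qed

lemma dim_theta_space:
  assumes h: "three_bullet G D h"
  shows "vdim (theta_space G D :: ('a \<Rightarrow>\<^sub>0 'f::field_char_0) set) = card D - card (hat_set G D)"
proof -
  have "vdim (theta_space G D :: ('a \<Rightarrow>\<^sub>0 'f) set) = vdim (matsuo_space (D - rep ` D) :: ('a \<Rightarrow>\<^sub>0 'f) set)"
    unfolding eigenspace_minus_one(2)[OF h]
    by (rule dim_image_inj[OF linear_diff_map subspace_matsuo_space inj_diff_map])
  also have "\<dots> = card D - card (hat_set G D)"
    using rep_image_sub finite_subset[OF rep_image_sub finite_D]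
    by (simp add: dim_matsuo_space card_Diff_subset card_rep_image)
  finally show ?thesis .
qed

end

section \<open>Assembly of eigenvalues, multiplicities and dimensions\<close>

theorem corollary10p4:
  fixes G :: "('g, 'm) monoid_scheme" and D :: "'g set"
    and \<eta> :: "'f::field_char_0" and h :: nat
  assumes "\<eta> \<noteq> 0" and "\<eta> \<noteq> 1"
    and "connected_three_transposition_group G D"
    and "theta_subgroup G D \<noteq> {\<one>\<^bsub>G\<^esub>}"
    and "three_bullet G D h"
  shows
    \<comment> \<open>(a)\<close>
    "(\<forall>\<rho> :: 'f. is_eigenvalue (collinearity_map G D) (matsuo_space D) \<rho> \<and> \<rho> \<noteq> -1 \<longrightarrow>
       (\<exists>\<rho>'. is_eigenvalue (collinearity_map (hat_group G D) (hat_set G D))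
                (matsuo_space (hat_set G D)) \<rho>' \<and>
              \<rho> = 3 ^ h * \<rho>' + 3 ^ h - 1)) \<and>
     (\<forall>\<rho> \<rho>' :: 'f. is_eigenvalue (collinearity_map (hat_group G D) (hat_set G D))
                (matsuo_space (hat_set G D)) \<rho>' \<and>
              \<rho> = 3 ^ h * \<rho>' + 3 ^ h - 1 \<and> \<rho> \<noteq> -1 \<longrightarrow>
       multiplicity_on (collinearity_map G D) (matsuo_space D) \<rho> =
       multiplicity_on (collinearity_map (hat_group G D) (hat_set G D))
         (matsuo_space (hat_set G D)) \<rho>') \<and>
     \<comment> \<open>(b)\<close>
     multiplicity_on (collinearity_map G D) (matsuo_space D) (-1 :: 'f) =
       vdim (theta_space G D :: ('g \<Rightarrow>\<^sub>0 'f) set) \<and>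
     int (vdim (theta_space G D :: ('g \<Rightarrow>\<^sub>0 'f) set)) =
       int (vdim (matsuo_space D :: ('g \<Rightarrow>\<^sub>0 'f) set)) -
       int (vdim (matsuo_space (hat_set G D) :: ('g set \<Rightarrow>\<^sub>0 'f) set)) \<and>
     int (vdim (matsuo_space D :: ('g \<Rightarrow>\<^sub>0 'f) set)) -
       int (vdim (matsuo_space (hat_set G D) :: ('g set \<Rightarrow>\<^sub>0 'f) set)) =
       int (card D) - int (card (hat_set G D)) \<and>
     int (card D) - int (card (hat_set G D)) = (3 ^ h - 1) * int (card (hat_set G D))"
proof -
  interpret connected_three_transposition_group G D by (rule assms(3))
  note h = assms(5)
  have card: "card D = 3 ^ h * card (hat_set G D)" by (rule card_D[OF h])
  \<comment> \<open>The product formula gives \<open>card (hat_set G D) \<le> card D\<close>, so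
    truncated subtraction is exact.\<close>
  then have "int (card D - card (hat_set G D)) = int (card D) - int (card (hat_set G D))"
    by (simp add: of_nat_diff)
  moreover have "int (card D) - int (card (hat_set G D)) = (3 ^ h - 1) * int (card (hat_set G D))"
    unfolding card by (simp add: algebra_simps)
  moreover have "multiplicity_on (collinearity_map G D) (matsuo_space D) (-1 :: 'f) =
      vdim (theta_space G D :: ('g \<Rightarrow>\<^sub>0 'f) set)"
    unfolding multiplicity_on_def eigenspace_minus_one(1)[OF h] ..
  moreover have "int (vdim (theta_space G D :: ('g \<Rightarrow>\<^sub>0 'f) set)) = int (card D - card (hat_set G D))"
    by (simp add: dim_theta_space[OF h])
  moreover have "int (vdim (matsuo_space D :: ('g \<Rightarrow>\<^sub>0 'f) set)) = int (card D)"
    "int (vdim (matsuo_space (hat_set G D) :: ('g set \<Rightarrow>\<^sub>0 'f) set)) = int (card (hat_set G D))"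
    by (simp_all add: dim_matsuo_space)
  ultimately show ?thesis
    using eigenvalue_from_hat[OF h, where 'f = 'f] multiplicity_lift[OF h, where 'f = 'f]
    by (intro conjI allI impI) auto
qed

end
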